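(* In the setting of the context (independent observations $X_1,\dots,X_n$, true parameter value $\theta\in\Theta$, $\Theta\subset\mathbb R$ open, preliminary consistent estimator $\theta_n^*$), suppose the following. (R2) With probability $1$, for every $i$, $M_i(t_2,X_i)-M_i(t_1,X_i)=\int_{t_1}^{t_2}M_i'(t,X_i)\,dt$ for every interval $(t_1,t_2)$ lying entirely in $\Theta$; moreover $\mathbf E M_i(\theta,X_i)=0$, $\mathbf E M_i^2(\theta,X_i)<\infty$, $\mathbf E|M_i'(\theta,X_i)|<\infty$ for every $i$; and for some $p\in(0,1]$, $|h_i(t_1)-h_i(t_2)|\le \overline h_i|t_1-t_2|^p$ for all $t_1,t_2\in\Theta$ and all $i$. (R3) For all sufficiently large $n$, $I_{n,h}:=\sum_{i=1}^n h_i^2(\theta)\mathbf E M_i^2(\theta,X_i)>0$ and $J_{n,h}:=\sum_{i=1}^n h_i(\theta)\mathbf E M_i'(\theta,X_i)\neq0$; and as $n\to\infty$: $|J_{n,h}|/\sqrt{I_{n,h}}\to\infty$, $\sum_{i=1}^n h_i(\theta)M_i'(\theta,X_i)/J_{n,h}\to 1$ in probability, and $\sum_{i=1}^n h_i(\theta)M_i(\theta,X_i)/\sqrt{I_{n,h}}\Rightarrow\mathcal N(0,1)$. (R4) $\lim_{\delta\to0}\limsup_{n\to\infty}\sum_{i=1}^n\big(|h_i(\theta)|+\delta^p\overline h_i\big)\overline\tau_i(\delta)/|J_{n,h}|=0$. (R5) $|\theta_n^*-\theta|\sum_{i=1}^n\big(\overline h_i|\theta_n^*-\theta|^p+|h_i(\theta)|\big)\overline\tau_i(|\theta_n^*-\theta|)/\sqrt{I_{n,h}}\to0$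 in probability and $|\theta_n^*-\theta|^p\sum_{i=1}^n\overline h_i\,\mathbf E|M_i'(\theta,X_i)|/|J_{n,h}|\to0$ in probability. (R6) $\sum_{i=1}^n\big(h_i(\theta_n^* )-h_i(\theta)\big)M_i(\theta,X_i)/\sqrt{I_{n,h}}\to0$ in probability. (R7) In probability, $$\frac{\sum_{i=1}^n h_i^2(\theta)M_i^2(\theta,X_i)}{I_{n,h}}\to1,\qquad \frac{\sum_{i=1}^n\big(\overline h_i^2+h_i^2(\theta)\big)[M_i'(\theta,X_i)]^2}{J_{n,h}^2}\to0,\qquad \frac{\sum_{i=1}^n\overline h_i^2M_i^2(\theta,X_i)}{|J_{n,h}|^{2p}I_{n,h}^{1-p}}\to0.$$ Let $$\theta_{n,M,h}^{**}=\theta_n^*-\frac{\sum_{i=1}^n h_i(\theta_n^* )M_i(\theta_n^*,X_i)}{\sum_{i=1}^n h_i(\theta_n^* )M_i'(\theta_n^*,X_i)},\qquad d_{n,M,h}^*=\frac{\sum_{i=1}^n h_i(\theta_n^* )M_i'(\theta_n^*,X_i)}{\Big(\sum_{i=1}^n h_i^2(\theta_{n,M,h}^{**})M_i^2(\theta_{n,M,h}^{**},X_i)\Big)^{1/2}}.$$ Then the statistic $d_{n,M,h}^*$ is well defined with probability tending to $1$ as $n\to\infty$, and $$d_{n,M,h}^*\big(\theta_{n,M,h}^{**}-\theta\big)\Longrightarrow\mathcal N(0,1).$$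
   Context: All limits are as $n\to\infty$ unless stated otherwise; $\Rightarrow$ denotes weak convergence of distributions. For each $n$ one observes independent (not necessarily identically distributed) random elements $X_1,\dots,X_n$ with values in an arbitrary measurable space $\mathcal X$; their distributions depend on an unknown parameter $\theta\in\Theta\subset\mathbb R$, $\Theta$ open, and may depend on $n$ (triangular array) and on nuisance parameters. $\theta$ denotes the fixed true value. For each $i$ there are given real functions $h_i(t)$, $M_i(t,X_i)$, $M_i'(t,X_i)$, $t\in\Theta$ (possibly depending on $n$; $M_i'$ plays the role of the derivative of $M_i$ in $t$), and constants $\overline h_i\ge0$ (possibly depending on $n$). $\theta_n^*$ is a real-valued statistic (function of $X_1,\dots,X_n$), a preliminary estimator consistent for $\theta$. For $\delta\ge0$ put $\overline\tau_i(\delta):=\mathbf E\,\tau_i(\delta,X_i)$, where $\tau_i(\delta,X_i):=\sup_{t:|t-\theta|\le\delta}|M_i'(t,X_i)-M_i'(\theta,X_i)|$ if $[\theta-\delta,\theta+\delta]\subset\Theta$, and $\tau_i(\delta,X_i):=\infty$ otherwise. Here $\overline\tau_i(|\theta_n^*-\theta|)$ means the deterministic function $\overline\tau_i(\cdot)$ evaluated at the random point $|\theta_n^*-\theta|$. A statistic is "well defined" at a sample point if all quantities in its formula are defined and its denominator is nonzero. *)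

theory Defs
  imports "HOL-Probability.Probability"
begin

text \<open>
  Triangular array: row \<open>n\<close> lives on its own probability space \<open>P n\<close> and consists of
  \<open>X n 1, \<dots>, X n n\<close>. For a single row, \<open>h i t\<close>, \<open>M i t x\<close>, \<open>M' i t x\<close> stand for
  \<open>h\<^sub>i(t)\<close>, \<open>M\<^sub>i(t,x)\<close>, \<open>M\<^sub>i'(t,x)\<close>; they are meaningful only for \<open>t \<in> \<Theta>\<close>,
  their values at other \<open>t\<close> being arbitrary.
\<close>

definition sample :: "(nat \<Rightarrow> nat \<Rightarrow> 'w \<Rightarrow> 'x) \<Rightarrow> nat \<Rightarrow> 'w \<Rightarrow> nat \<Rightarrow> 'x" where
  "sample X n \<omega> = (\<lambda>i\<in>{1..n}. X n i \<omega>)"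

definition tendsto_prob ::
    "(nat \<Rightarrow> 'w measure) \<Rightarrow> (nat \<Rightarrow> 'w \<Rightarrow> real) \<Rightarrow> real \<Rightarrow> bool" where
  "tendsto_prob P Y c \<longleftrightarrow>
     (\<forall>\<epsilon>>0. (\<lambda>n. measure (P n) {\<omega> \<in> space (P n). \<epsilon> < \<bar>Y n \<omega> - c\<bar>}) \<longlonglongrightarrow> 0)"

text \<open>Convergence to \<open>0\<close> in probability of variables with values in \<open>[0, \<infinity>]\<close>.\<close>

definition tendsto_prob_zero_ennreal ::
    "(nat \<Rightarrow> 'w measure) \<Rightarrow> (nat \<Rightarrow> 'w \<Rightarrow> ennreal) \<Rightarrow> bool" where
  "tendsto_prob_zero_ennreal P Y \<longleftrightarrow>
     (\<forall>\<epsilon>>0. (\<lambda>n. measure (P n) {\<omega> \<in> space (P n). \<epsilon> < Y n \<omega>}) \<longlonglongrightarrow> 0)"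

text \<open>A random variable \<open>f\<close> that is defined only at the points satisfying \<open>D\<close>.\<close>

definition rand_var_on :: "'w measure \<Rightarrow> ('w \<Rightarrow> bool) \<Rightarrow> ('w \<Rightarrow> real) \<Rightarrow> bool" where
  "rand_var_on P D f \<longleftrightarrow>
     {\<omega> \<in> space P. D \<omega>} \<in> sets P \<and>
     f \<in> borel_measurable (restrict_space P {\<omega> \<in> space P. D \<omega>})"

text \<open>The modulus \<open>\<tau>\<^sub>i(\<delta>,x)\<close>; the argument \<open>g\<close> is \<open>t \<mapsto> M\<^sub>i'(t,x)\<close>.\<close>

definition tau :: "real set \<Rightarrow> real \<Rightarrow> (real \<Rightarrow> real) \<Rightarrow> real \<Rightarrow> ennreal" where
  "tau \<Theta> \<theta> g \<delta> =
     (if {\<theta> - \<delta>..\<theta> + \<delta>} \<subseteq> \<Theta>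
      then (SUP t\<in>{t. \<bar>t - \<theta>\<bar> \<le> \<delta>}. ennreal \<bar>g t - g \<theta>\<bar>) else \<infinity>)"

definition tau_bar ::
    "'w measure \<Rightarrow> ('w \<Rightarrow> 'x) \<Rightarrow> real set \<Rightarrow> real \<Rightarrow> (real \<Rightarrow> 'x \<Rightarrow> real) \<Rightarrow> real \<Rightarrow> ennreal" where
  "tau_bar P Y \<Theta> \<theta> m' \<delta> = (\<integral>\<^sup>+ \<omega>. tau \<Theta> \<theta> (\<lambda>t. m' t (Y \<omega>)) \<delta> \<partial>P)"

definition I_nh :: "(nat \<Rightarrow> 'w measure) \<Rightarrow> (nat \<Rightarrow> nat \<Rightarrow> 'w \<Rightarrow> 'x) \<Rightarrow>
    (nat \<Rightarrow> nat \<Rightarrow> real \<Rightarrow> real) \<Rightarrow> (nat \<Rightarrow> nat \<Rightarrow> real \<Rightarrow> 'x \<Rightarrow> real) \<Rightarrow> real \<Rightarrow> nat \<Rightarrow> real" where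
  "I_nh P X h M \<theta> n =
     (\<Sum>i=1..n. (h n i \<theta>)\<^sup>2 * integral\<^sup>L (P n) (\<lambda>\<omega>. (M n i \<theta> (X n i \<omega>))\<^sup>2))"

definition J_nh :: "(nat \<Rightarrow> 'w measure) \<Rightarrow> (nat \<Rightarrow> nat \<Rightarrow> 'w \<Rightarrow> 'x) \<Rightarrow>
    (nat \<Rightarrow> nat \<Rightarrow> real \<Rightarrow> real) \<Rightarrow> (nat \<Rightarrow> nat \<Rightarrow> real \<Rightarrow> 'x \<Rightarrow> real) \<Rightarrow> real \<Rightarrow> nat \<Rightarrow> real" where
  "J_nh P X h M' \<theta> n =
     (\<Sum>i=1..n. h n i \<theta> * integral\<^sup>L (P n) (\<lambda>\<omega>. M' n i \<theta> (X n i \<omega>)))"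

text \<open>
  The one-step estimator and the normalizing statistic for a sample \<open>x\<close> of size \<open>n\<close> and a
  preliminary estimate \<open>t\<close>, each with the condition for it to be well defined.
\<close>

definition one_step :: "nat \<Rightarrow> (nat \<Rightarrow> real \<Rightarrow> real) \<Rightarrow> (nat \<Rightarrow> real \<Rightarrow> 'x \<Rightarrow> real) \<Rightarrow>
    (nat \<Rightarrow> real \<Rightarrow> 'x \<Rightarrow> real) \<Rightarrow> real \<Rightarrow> (nat \<Rightarrow> 'x) \<Rightarrow> real" where
  "one_step n h M M' t x =
     t - (\<Sum>i=1..n. h i t * M i t (x i)) / (\<Sum>i=1..n. h i t * M' i t (x i))"

definition one_step_defined :: "real set \<Rightarrow> nat \<Rightarrow> (nat \<Rightarrow> real \<Rightarrow> real) \<Rightarrow>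
    (nat \<Rightarrow> real \<Rightarrow> 'x \<Rightarrow> real) \<Rightarrow> real \<Rightarrow> (nat \<Rightarrow> 'x) \<Rightarrow> bool" where
  "one_step_defined \<Theta> n h M' t x \<longleftrightarrow>
     t \<in> \<Theta> \<and> (\<Sum>i=1..n. h i t * M' i t (x i)) \<noteq> 0"

definition d_star :: "nat \<Rightarrow> (nat \<Rightarrow> real \<Rightarrow> real) \<Rightarrow> (nat \<Rightarrow> real \<Rightarrow> 'x \<Rightarrow> real) \<Rightarrow>
    (nat \<Rightarrow> real \<Rightarrow> 'x \<Rightarrow> real) \<Rightarrow> real \<Rightarrow> (nat \<Rightarrow> 'x) \<Rightarrow> real" where
  "d_star n h M M' t x =
     (let s = one_step n h M M' t x
      in (\<Sum>i=1..n. h i t * M' i t (x i)) / sqrt (\<Sum>i=1..n. (h i s)\<^sup>2 * (M i s (x i))\<^sup>2))"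

definition d_star_defined :: "real set \<Rightarrow> nat \<Rightarrow> (nat \<Rightarrow> real \<Rightarrow> real) \<Rightarrow>
    (nat \<Rightarrow> real \<Rightarrow> 'x \<Rightarrow> real) \<Rightarrow> (nat \<Rightarrow> real \<Rightarrow> 'x \<Rightarrow> real) \<Rightarrow> real \<Rightarrow> (nat \<Rightarrow> 'x) \<Rightarrow> bool" where
  "d_star_defined \<Theta> n h M M' t x \<longleftrightarrow>
     (let s = one_step n h M M' t x
      in one_step_defined \<Theta> n h M' t x \<and> s \<in> \<Theta> \<and>
         sqrt (\<Sum>i=1..n. (h i s)\<^sup>2 * (M i s (x i))\<^sup>2) \<noteq> 0)"

end

theory Submission
  imports Defs
begin

text \<open>
Write \<open>t\<close> for the preliminary estimate, \<open>s\<close> for the one-step estimate, \<open>H\<close> and \<open>G\<close> for the sums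
of \<open>h\<^sub>i(t) M\<^sub>i'(t)\<close> and \<open>h\<^sub>i(t) M\<^sub>i(t)\<close>, \<open>Z\<close> for the normalized sum of \<open>h\<^sub>i(\<theta>) M\<^sub>i(\<theta>)\<close>, and \<open>N(s)\<close>
for the square root in the denominator of the studentizing statistic. By the definition of a Newton step,
\<open>(s - \<theta>) H = (t - \<theta>) H - G\<close>. A Taylor expansion of each \<open>M\<^sub>i\<close> between \<open>\<theta>\<close> and \<open>t\<close> shows that the
right-hand side is \<open>-\<surd>I (Z + E)\<close> with \<open>E\<close> tending to \<open>0\<close> in probability. Hence the studentized error
\<open>(H / N(s)) (s - \<theta>)\<close> equals \<open>-(Z + E) / V\<close> with \<open>V = N(s) / \<surd>I\<close>, and the theorem follows from
\<open>Z \<Rightarrow> N(0,1)\<close>, the symmetry of the normal law and Slutsky's lemma once \<open>V\<close> tends to \<open>1\<close> in probability.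

For \<open>V\<close>, the central limit theorem and \<open>H / J \<rightarrow> 1\<close> show that \<open>\<rho> = (s - \<theta>) J / \<surd>I\<close> is bounded in
probability, so \<open>s\<close> is consistent. The Minkowski inequality splits \<open>|N(s) - N(\<theta>)|\<close> into three terms
(\<open>norm_remainder\<close>), which after division by \<open>\<surd>I\<close> become powers of \<open>|\<rho>|\<close> times quantities that vanish
by (R7) and (R4).

All three remainder estimates rest on the same sum of moduli \<open>\<tau>\<^sub>i(\<delta>, X\<^sub>i)\<close>, called \<open>weighted_modulus\<close> below. The
delicate point is that the radius \<open>\<delta> = |t - \<theta>|\<close> is random and depends on the observations, while
(R5) controls only the mean of the modulus, evaluated at this random radius afterwards. Monotonicity
in \<open>\<delta>\<close> closes this gap: a high quantile of the radius is a deterministic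
radius at which the mean is still small, so Markov's inequality applies there (\<open>random_radius\<close>).

The functions \<open>M\<^sub>i(t, x)\<close> are measurable in \<open>x\<close> for fixed \<open>t\<close> but not jointly, so intermediate quantities with a
random \<open>t\<close> need not be random variables. Convergence in probability is therefore expressed through a filter of events that
contain measurable events of probability close to \<open>1\<close> (\<open>whp\<close>); the usual limit calculus then applies to
arbitrary functions on the sample spaces.
\<close>

section \<open>Convergence in probability as convergence along a filter\<close>

text \<open>
A property holds eventually along this filter if its inner probability tends to \<open>1\<close>. Exceptional sets
are bounded by measurable ones because the properties of interest need not be events.
\<close>

definition whp :: "(nat \<Rightarrow> 'w measure) \<Rightarrow> (nat \<times> 'w) filter" where
  "whp P = Abs_filter (\<lambda>Q. \<forall>\<eta>>0. \<forall>\<^sub>F n in sequentially.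
     \<exists>N\<in>sets (P n). measure (P n) N < \<eta> \<and> (\<forall>\<omega>\<in>space (P n) - N. Q (n, \<omega>)))"

lemma eventually_whp:
  "eventually Q (whp P) \<longleftrightarrow> (\<forall>\<eta>>0. \<forall>\<^sub>F n in sequentially.
     \<exists>N\<in>sets (P n). measure (P n) N < \<eta> \<and> (\<forall>\<omega>\<in>space (P n) - N. Q (n, \<omega>)))"
  unfolding whp_def
proof (rule eventually_Abs_filter, rule is_filter.intro)
  show "\<forall>\<eta>>0. \<forall>\<^sub>F n in sequentially.
     \<exists>N\<in>sets (P n). measure (P n) N < \<eta> \<and> (\<forall>\<omega>\<in>space (P n) - N. True)"
    by (auto intro!: always_eventually bexI[of _ "{}"])
next
  fix Q R :: "nat \<times> 'a \<Rightarrow> bool"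
  assume Q: "\<forall>\<eta>>0. \<forall>\<^sub>F n in sequentially.
      \<exists>N\<in>sets (P n). measure (P n) N < \<eta> \<and> (\<forall>\<omega>\<in>space (P n) - N. Q (n, \<omega>))"
    and R: "\<forall>\<eta>>0. \<forall>\<^sub>F n in sequentially.
      \<exists>N\<in>sets (P n). measure (P n) N < \<eta> \<and> (\<forall>\<omega>\<in>space (P n) - N. R (n, \<omega>))"
  show "\<forall>\<eta>>0. \<forall>\<^sub>F n in sequentially. \<exists>N\<in>sets (P n). measure (P n) N < \<eta> \<and>
      (\<forall>\<omega>\<in>space (P n) - N. Q (n, \<omega>) \<and> R (n, \<omega>))"
  proof (intro allI impI)
    fix \<eta> :: real assume "0 < \<eta>"
    then have "0 < \<eta> / 2" by simp
    from Q[rule_format, OF this] R[rule_format, OF this] have "\<forall>\<^sub>F n in sequentially.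
        (\<exists>N\<in>sets (P n). measure (P n) N < \<eta> / 2 \<and> (\<forall>\<omega>\<in>space (P n) - N. Q (n, \<omega>))) \<and>
        (\<exists>N\<in>sets (P n). measure (P n) N < \<eta> / 2 \<and> (\<forall>\<omega>\<in>space (P n) - N. R (n, \<omega>)))"
      by (rule eventually_conj)
    then show "\<forall>\<^sub>F n in sequentially. \<exists>N\<in>sets (P n). measure (P n) N < \<eta> \<and>
        (\<forall>\<omega>\<in>space (P n) - N. Q (n, \<omega>) \<and> R (n, \<omega>))"
    proof (eventually_elim, elim conjE bexE)
      fix n N N'
      assume N: "N \<in> sets (P n)" "measure (P n) N < \<eta> / 2" "\<forall>\<omega>\<in>space (P n) - N. Q (n, \<omega>)"
        and N': "N' \<in> sets (P n)" "measure (P n) N' < \<eta> / 2" "\<forall>\<omega>\<in>space (P n) - N'. R (n, \<omega>)"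
      have "measure (P n) (N \<union> N') < \<eta>"
        using measure_Un_le[OF N(1) N'(1)] N(2) N'(2) by linarith
      then show "\<exists>N\<in>sets (P n). measure (P n) N < \<eta> \<and>
          (\<forall>\<omega>\<in>space (P n) - N. Q (n, \<omega>) \<and> R (n, \<omega>))"
        using N N' by (intro bexI[of _ "N \<union> N'"]) auto
    qed
  qed
next
  fix Q R :: "nat \<times> 'a \<Rightarrow> bool"
  assume imp: "\<forall>x. Q x \<longrightarrow> R x" and Q: "\<forall>\<eta>>0. \<forall>\<^sub>F n in sequentially.
      \<exists>N\<in>sets (P n). measure (P n) N < \<eta> \<and> (\<forall>\<omega>\<in>space (P n) - N. Q (n, \<omega>))"
  show "\<forall>\<eta>>0. \<forall>\<^sub>F n in sequentially.
      \<exists>N\<in>sets (P n). measure (P n) N < \<eta> \<and> (\<forall>\<omega>\<in>space (P n) - N. R (n, \<omega>))"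
  proof (intro allI impI)
    fix \<eta> :: real assume "0 < \<eta>"
    with Q have "\<forall>\<^sub>F n in sequentially.
        \<exists>N\<in>sets (P n). measure (P n) N < \<eta> \<and> (\<forall>\<omega>\<in>space (P n) - N. Q (n, \<omega>))"
      by blast
    then show "\<forall>\<^sub>F n in sequentially.
        \<exists>N\<in>sets (P n). measure (P n) N < \<eta> \<and> (\<forall>\<omega>\<in>space (P n) - N. R (n, \<omega>))"
      by eventually_elim (use imp in blast)
  qed
qed

lemma whp_sequentially:
  assumes "\<forall>\<^sub>F n in sequentially. Q n"
  shows "\<forall>\<^sub>F x in whp P. Q (fst x)"
  unfolding eventually_whp
  by (intro allI impI eventually_mono[OF assms]) (auto intro!: bexI[of _ "{}"])

lemma filterlim_fst_whp: "filterlim fst sequentially (whp P)"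
  by (auto simp: filterlim_iff intro: whp_sequentially)

lemma whp_AE:
  assumes "\<And>n. AE \<omega> in P n. Q n \<omega>"
  shows "\<forall>\<^sub>F x in whp P. Q (fst x) (snd x)"
  unfolding eventually_whp
proof (intro allI impI always_eventually)
  fix \<eta> :: real and n assume "0 < \<eta>"
  obtain N where "N \<in> null_sets (P n)" "{\<omega> \<in> space (P n). \<not> Q n \<omega>} \<subseteq> N"
    using assms[of n] unfolding eventually_ae_filter by blast
  then show "\<exists>N\<in>sets (P n). measure (P n) N < \<eta> \<and>
      (\<forall>\<omega>\<in>space (P n) - N. Q (fst (n, \<omega>)) (snd (n, \<omega>)))"
    using \<open>0 < \<eta>\<close> by (intro bexI[of _ N]) (auto simp: null_sets_def measure_def)
qed

lemma whp_measure_compl: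
  assumes "\<And>n. {\<omega> \<in> space (P n). \<not> Q n \<omega>} \<in> sets (P n)"
    and "(\<lambda>n. measure (P n) {\<omega> \<in> space (P n). \<not> Q n \<omega>}) \<longlonglongrightarrow> 0"
  shows "\<forall>\<^sub>F x in whp P. Q (fst x) (snd x)"
  unfolding eventually_whp
proof (intro allI impI)
  fix \<eta> :: real assume "0 < \<eta>"
  then have "\<forall>\<^sub>F n in sequentially. measure (P n) {\<omega> \<in> space (P n). \<not> Q n \<omega>} < \<eta>"
    using assms(2) by (simp add: order_tendstoD)
  then show "\<forall>\<^sub>F n in sequentially. \<exists>N\<in>sets (P n). measure (P n) N < \<eta> \<and>
      (\<forall>\<omega>\<in>space (P n) - N. Q (fst (n, \<omega>)) (snd (n, \<omega>)))"
  proof eventually_elim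
    case (elim n)
    then show ?case
      using assms(1)[of n] by (intro bexI[of _ "{\<omega> \<in> space (P n). \<not> Q n \<omega>}"]) auto
  qed
qed

lemma measure_tendsto_0_whp:
  assumes "\<And>n. prob_space (P n)" and Q: "\<forall>\<^sub>F x in whp P. \<not> Q (fst x) (snd x)"
  shows "(\<lambda>n. measure (P n) {\<omega> \<in> space (P n). Q n \<omega>}) \<longlonglongrightarrow> 0"
proof (rule order_tendstoI)
  fix \<eta> :: real assume "0 < \<eta>"
  from Q[unfolded eventually_whp, rule_format, OF this]
  show "\<forall>\<^sub>F n in sequentially. measure (P n) {\<omega> \<in> space (P n). Q n \<omega>} < \<eta>"
  proof (eventually_elim, elim bexE conjE)
    fix n N assume N: "N \<in> sets (P n)" "measure (P n) N < \<eta>"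
      "\<forall>\<omega>\<in>space (P n) - N. \<not> Q (fst (n, \<omega>)) (snd (n, \<omega>))"
    interpret prob_space "P n" by (rule assms)
    have "measure (P n) {\<omega> \<in> space (P n). Q n \<omega>} \<le> measure (P n) N"
      using N by (intro finite_measure_mono) auto
    with N(2) show "measure (P n) {\<omega> \<in> space (P n). Q n \<omega>} < \<eta>" by simp
  qed
qed (auto intro!: always_eventually less_le_trans[OF _ measure_nonneg])

lemma measure_tendsto_1_whp:
  assumes P: "\<And>n. prob_space (P n)" and sets: "\<And>n. {\<omega> \<in> space (P n). Q n \<omega>} \<in> sets (P n)"
    and Q: "\<forall>\<^sub>F x in whp P. Q (fst x) (snd x)"
  shows "(\<lambda>n. measure (P n) {\<omega> \<in> space (P n). Q n \<omega>}) \<longlonglongrightarrow> 1"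
proof -
  have "(\<lambda>n. 1 - measure (P n) {\<omega> \<in> space (P n). \<not> Q n \<omega>}) \<longlonglongrightarrow> 1 - 0"
    using Q by (intro tendsto_diff tendsto_const measure_tendsto_0_whp P) simp
  moreover have "1 - measure (P n) {\<omega> \<in> space (P n). \<not> Q n \<omega>}
      = measure (P n) {\<omega> \<in> space (P n). Q n \<omega>}" for n
    using prob_space.prob_compl[OF P sets[of n]]
    by (simp add: set_diff_eq conj_commute Collect_conj_eq[symmetric])
       (smt (verit, best) Collect_cong)
  ultimately show ?thesis by simp
qed

text \<open>
Measurability is essential here: \<open>measure\<close> assigns \<open>0\<close> to every nonmeasurable set, so that
\<open>tendsto_prob\<close> holds vacuously when the deviation sets are not events.
\<close>

lemma tendsto_whp_of_tendsto_prob: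
  assumes "tendsto_prob P Y c" and [measurable]: "\<And>n. Y n \<in> borel_measurable (P n)"
  shows "((\<lambda>x. Y (fst x) (snd x)) \<longlongrightarrow> c) (whp P)"
proof (rule tendstoI)
  fix e :: real assume "0 < e"
  then have "0 < e / 2" by simp
  have "\<forall>\<^sub>F x in whp P. \<bar>Y (fst x) (snd x) - c\<bar> \<le> e / 2"
  proof (rule whp_measure_compl)
    show "(\<lambda>n. measure (P n) {\<omega> \<in> space (P n). \<not> \<bar>Y n \<omega> - c\<bar> \<le> e / 2}) \<longlonglongrightarrow> 0"
      using assms(1)[unfolded tendsto_prob_def, rule_format, OF \<open>0 < e / 2\<close>]
      unfolding not_le .
  qed measurable
  then show "\<forall>\<^sub>F x in whp P. dist (Y (fst x) (snd x)) c < e"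
    by eventually_elim (use \<open>0 < e\<close> in \<open>simp add: dist_real_def\<close>)
qed

lemma tendsto_whp_of_tendsto_prob_ennreal:
  assumes "tendsto_prob_zero_ennreal P Y" and [measurable]: "\<And>n. Y n \<in> borel_measurable (P n)"
  shows "((\<lambda>x. Y (fst x) (snd x)) \<longlongrightarrow> 0) (whp P)"
proof (rule order_tendstoI)
  fix e :: ennreal assume "0 < e"
  then obtain e' where e': "0 < e'" "e' < e" using dense by blast
  have "\<forall>\<^sub>F x in whp P. Y (fst x) (snd x) \<le> e'"
  proof (rule whp_measure_compl)
    show "(\<lambda>n. measure (P n) {\<omega> \<in> space (P n). \<not> Y n \<omega> \<le> e'}) \<longlonglongrightarrow> 0"
      using assms(1) e' unfolding tendsto_prob_zero_ennreal_def by (simp add: not_le)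
  qed measurable
  then show "\<forall>\<^sub>F x in whp P. Y (fst x) (snd x) < e"
    by eventually_elim (use e' in auto)
qed auto

lemma tendsto_0_ennreal_comparison:
  fixes f :: "'i \<Rightarrow> real"
  assumes "(Q \<longlongrightarrow> 0) F" "\<forall>\<^sub>F x in F. ennreal \<bar>f x\<bar> \<le> Q x"
  shows "(f \<longlongrightarrow> 0) F"
proof -
  have "((\<lambda>x. ennreal \<bar>f x\<bar>) \<longlongrightarrow> 0) F"
    by (rule tendsto_sandwich[OF _ assms(2) tendsto_const assms(1)]) simp
  then have "((\<lambda>x. ennreal \<bar>f x\<bar>) \<longlongrightarrow> ennreal 0) F" by simp
  then have "((\<lambda>x. \<bar>f x\<bar>) \<longlongrightarrow> 0) F"
    by (subst (asm) tendsto_ennreal_iff) simp_all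
  then show ?thesis by (rule tendsto_rabs_zero_cancel)
qed

section \<open>Boundedness in probability\<close>

text \<open>
Tightness, expressed by its only use: the product with anything that vanishes in probability vanishes in
probability. In this form closure under sums and products is immediate.
\<close>

definition stoch_bounded :: "(nat \<Rightarrow> 'w measure) \<Rightarrow> (nat \<times> 'w \<Rightarrow> real) \<Rightarrow> bool" where
  "stoch_bounded P Y \<longleftrightarrow>
     (\<forall>W. (W \<longlongrightarrow> 0) (whp P) \<longrightarrow> ((\<lambda>x. Y x * W x) \<longlongrightarrow> 0) (whp P))"

lemma stoch_boundedD:
  "stoch_bounded P Y \<Longrightarrow> (W \<longlongrightarrow> 0) (whp P) \<Longrightarrow> ((\<lambda>x. Y x * W x) \<longlongrightarrow> 0) (whp P)"
  unfolding stoch_bounded_def by blast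

lemma stoch_bounded_tendsto: "(Y \<longlongrightarrow> c) (whp P) \<Longrightarrow> stoch_bounded P Y"
  unfolding stoch_bounded_def using tendsto_mult[of Y c "whp P" _ 0] by simp

lemma stoch_bounded_mult:
  assumes "stoch_bounded P Y" "stoch_bounded P Z"
  shows "stoch_bounded P (\<lambda>x. Y x * Z x)"
  unfolding stoch_bounded_def using assms stoch_boundedD by (simp add: mult.assoc) blast

lemma stoch_bounded_add:
  assumes "stoch_bounded P Y" "stoch_bounded P Z"
  shows "stoch_bounded P (\<lambda>x. Y x + Z x)"
  unfolding stoch_bounded_def
  using assms tendsto_add[OF stoch_boundedD stoch_boundedD, of P Y _ Z] by (simp add: distrib_right)

lemma stoch_bounded_mono:
  assumes Z: "stoch_bounded P Z" and le: "\<forall>\<^sub>F x in whp P. \<bar>Y x\<bar> \<le> \<bar>Z x\<bar>"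
  shows "stoch_bounded P Y"
  unfolding stoch_bounded_def
proof (intro allI impI)
  fix W :: "nat \<times> 'a \<Rightarrow> real" assume W: "(W \<longlongrightarrow> 0) (whp P)"
  show "((\<lambda>x. Y x * W x) \<longlongrightarrow> 0) (whp P)"
  proof (rule Lim_null_comparison)
    show "\<forall>\<^sub>F x in whp P. norm (Y x * W x) \<le> \<bar>Z x * W x\<bar>"
      using le by eventually_elim (simp add: abs_mult mult_right_mono)
    show "((\<lambda>x. \<bar>Z x * W x\<bar>) \<longlongrightarrow> 0) (whp P)"
      by (rule tendsto_rabs_zero[OF stoch_boundedD[OF Z W]])
  qed
qed

text \<open>
The customary quantile formulation of tightness implies the one above: off an event of probability less
than \<open>\<eta> / 2\<close> the factor \<open>Y\<close> is at most a constant \<open>K\<close>, which an accuracy of order \<open>e / K\<close> for \<open>W\<close> absorbs.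
\<close>

lemma stoch_boundedI:
  assumes "\<And>\<eta>. 0 < \<eta> \<Longrightarrow> \<exists>K. \<forall>\<^sub>F n in sequentially.
    \<exists>N\<in>sets (P n). measure (P n) N < \<eta> \<and> (\<forall>\<omega>\<in>space (P n) - N. \<bar>Y (n, \<omega>)\<bar> \<le> K)"
  shows "stoch_bounded P Y"
  unfolding stoch_bounded_def
proof (intro allI impI tendstoI)
  fix W :: "nat \<times> 'a \<Rightarrow> real" and e :: real assume W: "(W \<longlongrightarrow> 0) (whp P)" and "0 < e"
  show "\<forall>\<^sub>F x in whp P. dist (Y x * W x) 0 < e"
    unfolding eventually_whp
  proof (intro allI impI)
    fix \<eta> :: real assume "0 < \<eta>"
    then have "0 < \<eta> / 2" by simp
    from assms[OF this] obtain K where K: "\<forall>\<^sub>F n in sequentially.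
      \<exists>N\<in>sets (P n). measure (P n) N < \<eta> / 2 \<and> (\<forall>\<omega>\<in>space (P n) - N. \<bar>Y (n, \<omega>)\<bar> \<le> K)" ..
    have "0 < e / (\<bar>K\<bar> + 1)" using \<open>0 < e\<close> by simp
    with W have "\<forall>\<^sub>F x in whp P. dist (W x) 0 < e / (\<bar>K\<bar> + 1)" by (rule tendstoD)
    then have "\<forall>\<^sub>F n in sequentially. \<exists>N\<in>sets (P n). measure (P n) N < \<eta> / 2 \<and>
        (\<forall>\<omega>\<in>space (P n) - N. dist (W (n, \<omega>)) 0 < e / (\<bar>K\<bar> + 1))"
      using \<open>0 < \<eta> / 2\<close> unfolding eventually_whp by blast
    with K show "\<forall>\<^sub>F n in sequentially. \<exists>N\<in>sets (P n). measure (P n) N < \<eta> \<and>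
        (\<forall>\<omega>\<in>space (P n) - N. dist (Y (n, \<omega>) * W (n, \<omega>)) 0 < e)"
    proof (eventually_elim, elim conjE bexE)
      fix n N N'
      assume N: "N \<in> sets (P n)" "measure (P n) N < \<eta> / 2" "\<forall>\<omega>\<in>space (P n) - N. \<bar>Y (n, \<omega>)\<bar> \<le> K"
        and N': "N' \<in> sets (P n)" "measure (P n) N' < \<eta> / 2"
          "\<forall>\<omega>\<in>space (P n) - N'. dist (W (n, \<omega>)) 0 < e / (\<bar>K\<bar> + 1)"
      have "measure (P n) (N \<union> N') < \<eta>"
        using measure_Un_le[OF N(1) N'(1)] N(2) N'(2) by linarith
      moreover have "dist (Y (n, \<omega>) * W (n, \<omega>)) 0 < e" if "\<omega> \<in> space (P n) - (N \<union> N')" for \<omega>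
      proof -
        have "\<bar>Y (n, \<omega>)\<bar> \<le> \<bar>K\<bar> + 1" "\<bar>W (n, \<omega>)\<bar> < e / (\<bar>K\<bar> + 1)"
          using N(3) N'(3) that by (auto simp: dist_real_def intro: order_trans)
        then have "\<bar>Y (n, \<omega>)\<bar> * \<bar>W (n, \<omega>)\<bar> \<le> (\<bar>K\<bar> + 1) * \<bar>W (n, \<omega>)\<bar>"
          by (intro mult_right_mono) auto
        also have "\<dots> < e"
          using \<open>\<bar>W (n, \<omega>)\<bar> < e / (\<bar>K\<bar> + 1)\<close> by (simp add: pos_less_divide_eq mult.commute)
        finally show ?thesis by (simp add: dist_real_def abs_mult)
      qed
      ultimately show "\<exists>N\<in>sets (P n). measure (P n) N < \<eta> \<and>
          (\<forall>\<omega>\<in>space (P n) - N. dist (Y (n, \<omega>) * W (n, \<omega>)) 0 < e)"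
        using N(1) N'(1) by (intro bexI[of _ "N \<union> N'"]) auto
    qed
  qed
qed

lemma stoch_bounded_weak_conv:
  assumes P: "\<And>n. prob_space (P n)" and [measurable]: "\<And>n. Y n \<in> borel_measurable (P n)"
    and \<mu>: "real_distribution \<mu>" and atomless: "\<And>x. measure \<mu> {x} = 0"
    and conv: "weak_conv_m (\<lambda>n. distr (P n) borel (Y n)) \<mu>"
  shows "stoch_bounded P (\<lambda>x. Y (fst x) (snd x))"
proof (rule stoch_boundedI)
  fix \<eta> :: real assume "0 < \<eta>"
  interpret \<mu>: real_distribution \<mu> by fact
  have conv: "(\<lambda>n. measure (P n) {\<omega> \<in> space (P n). Y n \<omega> \<le> x}) \<longlonglongrightarrow> cdf \<mu> x" for x
  proof -
    have "(\<lambda>n. cdf (distr (P n) borel (Y n)) x) \<longlonglongrightarrow> cdf \<mu> x"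
      using conv atomless unfolding weak_conv_m_def weak_conv_def by (simp add: \<mu>.isCont_cdf)
    then show ?thesis
      by (simp add: cdf_def2 measure_distr vimage_def Int_def conj_commute)
  qed
  have "\<forall>\<^sub>F K in at_top. cdf \<mu> K > 1 - \<eta> / 2"
    using \<mu>.cdf_lim_at_top_prob \<open>0 < \<eta>\<close> by (intro order_tendstoD(1)) auto
  moreover have "\<forall>\<^sub>F K in at_top. cdf \<mu> (- K) < \<eta> / 2"
    using \<mu>.cdf_lim_at_bot \<open>0 < \<eta>\<close>
    by (intro order_tendstoD(2)[OF filterlim_compose[OF _ filterlim_uminus_at_bot_at_top]]) auto
  ultimately obtain K where K: "cdf \<mu> K > 1 - \<eta> / 2" "cdf \<mu> (- K) < \<eta> / 2"
    using eventually_happens'[OF _ eventually_conj] by (metis (mono_tags, lifting) trivial_limit_at_top_linorder)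
  show "\<exists>K. \<forall>\<^sub>F n in sequentially. \<exists>N\<in>sets (P n). measure (P n) N < \<eta> \<and>
      (\<forall>\<omega>\<in>space (P n) - N. \<bar>Y (fst (n, \<omega>)) (snd (n, \<omega>))\<bar> \<le> K)"
  proof
    show "\<forall>\<^sub>F n in sequentially. \<exists>N\<in>sets (P n). measure (P n) N < \<eta> \<and>
        (\<forall>\<omega>\<in>space (P n) - N. \<bar>Y (fst (n, \<omega>)) (snd (n, \<omega>))\<bar> \<le> K)"
      using order_tendstoD(1)[OF conv K(1)] order_tendstoD(2)[OF conv K(2)]
    proof eventually_elim
      case (elim n)
      interpret prob_space "P n" by (rule P)
      let ?N = "{\<omega> \<in> space (P n). Y n \<omega> \<le> - K} \<union> (space (P n) - {\<omega> \<in> space (P n). Y n \<omega> \<le> K})"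
      have "prob ?N \<le> prob {\<omega> \<in> space (P n). Y n \<omega> \<le> - K} +
          prob (space (P n) - {\<omega> \<in> space (P n). Y n \<omega> \<le> K})"
        by (rule measure_Un_le) measurable
      also have "\<dots> < \<eta>"
        using elim by (subst prob_compl) auto
      finally show ?case by (intro bexI[of _ ?N]) auto
    qed
  qed
qed

section \<open>Weak convergence: continuous mapping and Slutsky's lemma\<close>

lemma weak_conv_m_distr_continuous:
  assumes M: "\<And>n. real_distribution (M n)" "real_distribution \<mu>" and conv: "weak_conv_m M \<mu>"
    and g: "\<And>x. isCont g x"
  shows "weak_conv_m (\<lambda>n. distr (M n) borel g) (distr \<mu> borel g)"
proof -
  interpret M: real_distribution "M n" for n by (rule M)
  interpret \<mu>: real_distribution \<mu> by (rule M)
  have g_meas[measurable]: "g \<in> borel_measurable borel"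
    by (intro borel_measurable_continuous_onI continuous_at_imp_continuous_on ballI g)
  show ?thesis
  proof (rule integral_bdd_continuous_conv_imp_weak_conv)
    fix f :: "real \<Rightarrow> real" assume f: "\<And>x. isCont f x" "\<And>x. \<bar>f x\<bar> \<le> 1"
    have [measurable]: "f \<in> borel_measurable borel"
      by (intro borel_measurable_continuous_onI continuous_at_imp_continuous_on ballI f)
    have "(\<lambda>n. \<integral>x. f (g x) \<partial>M n) \<longlonglongrightarrow> (\<integral>x. f (g x) \<partial>\<mu>)"
      using f g by (intro weak_conv_imp_integral_bdd_continuous_conv[OF M conv, where B = 1])
        (auto intro: isCont_o2)
    then show "(\<lambda>n. integral\<^sup>L (distr (M n) borel g) f) \<longlonglongrightarrow> integral\<^sup>L (distr \<mu> borel g) f"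
      by (simp add: integral_distr)
  qed (auto intro!: M.real_distribution_distr \<mu>.real_distribution_distr)
qed

text \<open>
The event \<open>W \<le> x\<close> lies between \<open>Y \<le> x - e / 2\<close> and \<open>Y \<le> x + e / 2\<close> up to \<open>|W - Y| \<ge> e / 2\<close>. Since the
limit law has no atoms, the distribution functions of \<open>Y\<close> converge at the shifted points too, and the
shift may then be removed by continuity.
\<close>

lemma slutsky:
  assumes P: "\<And>n. prob_space (P n)"
    and [measurable]: "\<And>n. Y n \<in> borel_measurable (P n)" "\<And>n. W n \<in> borel_measurable (P n)"
    and \<mu>: "real_distribution \<mu>" and atomless: "\<And>x. measure \<mu> {x} = 0"
    and conv: "weak_conv_m (\<lambda>n. distr (P n) borel (Y n)) \<mu>"
    and diff: "((\<lambda>x. W (fst x) (snd x) - Y (fst x) (snd x)) \<longlongrightarrow> 0) (whp P)"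
  shows "weak_conv_m (\<lambda>n. distr (P n) borel (W n)) \<mu>"
  unfolding weak_conv_m_def weak_conv_def
proof (intro allI impI)
  fix x
  interpret \<mu>: real_distribution \<mu> by fact
  have conv: "(\<lambda>n. measure (P n) {\<omega> \<in> space (P n). Y n \<omega> \<le> x}) \<longlonglongrightarrow> cdf \<mu> x" for x
  proof -
    have "(\<lambda>n. cdf (distr (P n) borel (Y n)) x) \<longlonglongrightarrow> cdf \<mu> x"
      using conv atomless unfolding weak_conv_m_def weak_conv_def by (simp add: \<mu>.isCont_cdf)
    then show ?thesis
      by (simp add: cdf_def2 measure_distr vimage_def Int_def conj_commute)
  qed
  have small: "(\<lambda>n. measure (P n) {\<omega> \<in> space (P n). e \<le> \<bar>W n \<omega> - Y n \<omega>\<bar>}) \<longlonglongrightarrow> 0" if "0 < e" for e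
  proof (rule measure_tendsto_0_whp[OF P])
    show "\<forall>\<^sub>F x in whp P. \<not> e \<le> \<bar>W (fst x) (snd x) - Y (fst x) (snd x)\<bar>"
      using tendstoD[OF diff that] by eventually_elim (simp add: dist_real_def)
  qed
  have "isCont (cdf \<mu>) x" by (simp add: \<mu>.isCont_cdf atomless)
  have "(\<lambda>n. measure (P n) {\<omega> \<in> space (P n). W n \<omega> \<le> x}) \<longlonglongrightarrow> cdf \<mu> x"
  proof (rule order_tendstoI)
    fix a assume "a < cdf \<mu> x"
    then have "\<forall>\<^sub>F y in at x. a < cdf \<mu> y"
      using \<open>isCont (cdf \<mu>) x\<close> by (intro order_tendstoD(1)) (simp_all add: isCont_def)
    then obtain e where e: "0 < e" "\<And>y. y \<noteq> x \<Longrightarrow> dist y x < e \<Longrightarrow> a < cdf \<mu> y"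
      unfolding eventually_at by auto
    define y where "y = x - e / 2"
    have "a < cdf \<mu> y" using e by (auto simp: y_def dist_real_def)
    have "(\<lambda>n. measure (P n) {\<omega> \<in> space (P n). Y n \<omega> \<le> y} -
        measure (P n) {\<omega> \<in> space (P n). e / 2 \<le> \<bar>W n \<omega> - Y n \<omega>\<bar>}) \<longlonglongrightarrow> cdf \<mu> y - 0"
      using e by (intro tendsto_diff conv small) auto
    then have "\<forall>\<^sub>F n in sequentially. a < measure (P n) {\<omega> \<in> space (P n). Y n \<omega> \<le> y} -
        measure (P n) {\<omega> \<in> space (P n). e / 2 \<le> \<bar>W n \<omega> - Y n \<omega>\<bar>}"
      using \<open>a < cdf \<mu> y\<close> by (intro order_tendstoD(1)) auto
    then show "\<forall>\<^sub>F n in sequentially. a < measure (P n) {\<omega> \<in> space (P n). W n \<omega> \<le> x}"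
    proof eventually_elim
      case (elim n)
      interpret prob_space "P n" by (rule P)
      have "W n \<omega> \<le> x \<or> e / 2 \<le> \<bar>W n \<omega> - Y n \<omega>\<bar>" if "Y n \<omega> \<le> y" for \<omega>
        using that unfolding y_def by arith
      then have "prob {\<omega> \<in> space (P n). Y n \<omega> \<le> y} \<le> prob ({\<omega> \<in> space (P n). W n \<omega> \<le> x} \<union>
          {\<omega> \<in> space (P n). e / 2 \<le> \<bar>W n \<omega> - Y n \<omega>\<bar>})"
        by (intro finite_measure_mono) auto
      also have "\<dots> \<le> prob {\<omega> \<in> space (P n). W n \<omega> \<le> x} +
          prob {\<omega> \<in> space (P n). e / 2 \<le> \<bar>W n \<omega> - Y n \<omega>\<bar>}"
        by (rule measure_Un_le) measurable
      finally show ?case using elim by simp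
    qed
  next
    fix a assume "cdf \<mu> x < a"
    then have "\<forall>\<^sub>F y in at x. cdf \<mu> y < a"
      using \<open>isCont (cdf \<mu>) x\<close> by (intro order_tendstoD(2)) (simp_all add: isCont_def)
    then obtain e where e: "0 < e" "\<And>y. y \<noteq> x \<Longrightarrow> dist y x < e \<Longrightarrow> cdf \<mu> y < a"
      unfolding eventually_at by auto
    define y where "y = x + e / 2"
    have "cdf \<mu> y < a" using e by (auto simp: y_def dist_real_def)
    have "(\<lambda>n. measure (P n) {\<omega> \<in> space (P n). Y n \<omega> \<le> y} +
        measure (P n) {\<omega> \<in> space (P n). e / 2 \<le> \<bar>W n \<omega> - Y n \<omega>\<bar>}) \<longlonglongrightarrow> cdf \<mu> y + 0"
      using e by (intro tendsto_add conv small) auto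
    then have "\<forall>\<^sub>F n in sequentially. measure (P n) {\<omega> \<in> space (P n). Y n \<omega> \<le> y} +
        measure (P n) {\<omega> \<in> space (P n). e / 2 \<le> \<bar>W n \<omega> - Y n \<omega>\<bar>} < a"
      using \<open>cdf \<mu> y < a\<close> by (intro order_tendstoD(2)) auto
    then show "\<forall>\<^sub>F n in sequentially. measure (P n) {\<omega> \<in> space (P n). W n \<omega> \<le> x} < a"
    proof eventually_elim
      case (elim n)
      interpret prob_space "P n" by (rule P)
      have "Y n \<omega> \<le> y \<or> e / 2 \<le> \<bar>W n \<omega> - Y n \<omega>\<bar>" if "W n \<omega> \<le> x" for \<omega>
        using that unfolding y_def by arith
      then have "prob {\<omega> \<in> space (P n). W n \<omega> \<le> x} \<le> prob ({\<omega> \<in> space (P n). Y n \<omega> \<le> y} \<union>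
          {\<omega> \<in> space (P n). e / 2 \<le> \<bar>W n \<omega> - Y n \<omega>\<bar>})"
        by (intro finite_measure_mono) auto
      also have "\<dots> \<le> prob {\<omega> \<in> space (P n). Y n \<omega> \<le> y} +
          prob {\<omega> \<in> space (P n). e / 2 \<le> \<bar>W n \<omega> - Y n \<omega>\<bar>}"
        by (rule measure_Un_le) measurable
      finally show ?case using elim by simp
    qed
  qed
  then show "(\<lambda>n. cdf (distr (P n) borel (W n)) x) \<longlonglongrightarrow> cdf \<mu> x"
    by (simp add: cdf_def2 measure_distr vimage_def Int_def conj_commute)
qed

lemma std_normal_atomless: "measure std_normal_distribution {x} = 0"
proof -
  have "emeasure std_normal_distribution {x} = 0"
    by (subst emeasure_density) (auto simp: nn_integral_cmult_indicator
      intro!: nn_integral_0_iff_AE[THEN iffD2] AE_mp[OF AE_lborel_singleton[of x]] AE_I2)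
  then show ?thesis by (simp add: measure_def)
qed

lemma std_normal_symmetric: "distr std_normal_distribution borel uminus = std_normal_distribution"
proof -
  interpret std: real_distribution std_normal_distribution by (rule real_dist_normal_dist)
  have "distributed std_normal_distribution lborel (\<lambda>x. x) std_normal_density"
    unfolding distributed_def by (auto simp: distr_id2)
  from std.normal_density_affine[OF this, of "-1" 0]
  have "distributed std_normal_distribution lborel (\<lambda>x. - x) std_normal_density" by simp
  then have "distr std_normal_distribution lborel uminus = std_normal_distribution"
    by (simp add: distributed_def)
  moreover have "distr std_normal_distribution lborel uminus = distr std_normal_distribution borel uminus"
    by (intro distr_cong) auto
  ultimately show ?thesis by simp
qed

section \<open>Monotone moduli at a random radius\<close>

lemma (in prob_space) markov_ennreal:
  assumes [measurable]: "f \<in> borel_measurable M" and "0 < e" "0 < \<eta>"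
    and le: "(\<integral>\<^sup>+x. f x \<partial>M) < ennreal (e * \<eta>)"
  shows "prob {x \<in> space M. ennreal e \<le> f x} < \<eta>"
proof -
  have "ennreal e * emeasure M {x \<in> space M. ennreal e \<le> f x}
      = (\<integral>\<^sup>+x. ennreal e * indicator {x \<in> space M. ennreal e \<le> f x} x \<partial>M)"
    by (subst nn_integral_cmult_indicator) auto
  also have "\<dots> \<le> (\<integral>\<^sup>+x. f x \<partial>M)"
    by (intro nn_integral_mono) (auto simp: indicator_def)
  also note le
  finally have "ennreal (e * prob {x \<in> space M. ennreal e \<le> f x}) < ennreal (e * \<eta>)"
    using \<open>0 < e\<close> by (simp add: emeasure_eq_measure ennreal_mult)
  then show ?thesis using \<open>0 < e\<close> \<open>0 < \<eta>\<close> by (simp add: ennreal_less_iff)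
qed

lemma (in prob_space) quantile:
  fixes D :: "'a \<Rightarrow> real"
  assumes [measurable]: "D \<in> borel_measurable M" and \<eta>: "0 < \<eta>" "\<eta> < 1"
  obtains c where "prob {\<omega> \<in> space M. c < D \<omega>} \<le> \<eta>" "\<eta> \<le> prob {\<omega> \<in> space M. c \<le> D \<omega>}"
proof -
  interpret D: cdf_distribution "distr M borel D"
    unfolding cdf_distribution_def by simp
  define c where "c = Inf {x. 1 - \<eta> \<le> cdf (distr M borel D) x}"
  have iff: "1 - \<eta> \<le> cdf (distr M borel D) x \<longleftrightarrow> c \<le> x" for x
    unfolding c_def using \<eta> by (intro D.pseudoinverse) auto
  show thesis
  proof
    have "1 - \<eta> \<le> prob {\<omega> \<in> space M. D \<omega> \<le> c}"
      using iff[of c] by (simp add: cdf_def2 measure_distr vimage_def Int_def conj_commute)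
    also have "\<dots> = 1 - prob {\<omega> \<in> space M. c < D \<omega>}"
      by (subst prob_neg[symmetric]) (auto simp: not_less)
    finally show "prob {\<omega> \<in> space M. c < D \<omega>} \<le> \<eta>" by simp
    have "(cdf (distr M borel D) \<longlongrightarrow> measure (distr M borel D) {..<c}) (at_left c)"
      by (rule D.cdf_at_left)
    moreover have "\<forall>\<^sub>F x in at_left c. cdf (distr M borel D) x \<le> 1 - \<eta>"
      using iff by (auto simp: eventually_at_filter not_le intro!: always_eventually less_imp_le)
        (metis linorder_not_le nle_le)
    ultimately have "measure (distr M borel D) {..<c} \<le> 1 - \<eta>"
      by (intro tendsto_upperbound) auto
    then have "prob {\<omega> \<in> space M. D \<omega> < c} \<le> 1 - \<eta>"
      by (simp add: measure_distr vimage_def Int_def conj_commute)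
    moreover have "prob {\<omega> \<in> space M. D \<omega> < c} = 1 - prob {\<omega> \<in> space M. c \<le> D \<omega>}"
      by (subst prob_neg[symmetric]) (auto simp: not_le)
    ultimately show "\<eta> \<le> prob {\<omega> \<in> space M. c \<le> D \<omega>}" by simp
  qed
qed

text \<open>
The hypothesis integrates \<open>A n r\<close> at a fixed radius \<open>r\<close> and inserts the random radius \<open>D\<close> only afterwards;
the conclusion inserts \<open>D\<close> before integrating, and \<open>D\<close> may depend on the randomness of \<open>A\<close>. Let \<open>c\<close>
be a quantile of \<open>D\<close> with \<open>P(D > c) \<le> \<eta> \<le> P(D \<ge> c)\<close>. As \<open>D \<ge> c\<close> is more likely than the exceptional
event of the hypothesis, some sample point satisfies both \<open>D \<ge> c\<close> and the bound on the mean at \<open>D\<close>, so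
by monotonicity the mean at \<open>c\<close> is small. Markov's inequality at the deterministic radius \<open>c\<close> then
controls \<open>A\<close> at every \<open>D \<le> c\<close>.
\<close>

lemma random_radius:
  fixes A :: "nat \<Rightarrow> real \<Rightarrow> 'w \<Rightarrow> ennreal"
  assumes P: "\<And>n. prob_space (P n)" and D[measurable]: "\<And>n. D n \<in> borel_measurable (P n)"
    and nonneg: "\<And>n \<omega>. 0 \<le> D n \<omega>"
    and A[measurable]: "\<And>n r. 0 \<le> r \<Longrightarrow> A n r \<in> borel_measurable (P n)"
    and mono: "\<And>n r r' \<omega>. 0 \<le> r \<Longrightarrow> r \<le> r' \<Longrightarrow> A n r \<omega> \<le> A n r' \<omega>"
    and lim: "((\<lambda>x. \<integral>\<^sup>+\<omega>. A (fst x) (D (fst x) (snd x)) \<omega> \<partial>P (fst x)) \<longlongrightarrow> 0) (whp P)"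
  shows "((\<lambda>x. A (fst x) (D (fst x) (snd x)) (snd x)) \<longlongrightarrow> 0) (whp P)"
proof (rule order_tendstoI)
  fix e' :: ennreal assume "0 < e'"
  then obtain e where e: "0 < e" "ennreal e < e'"
    by (metis dense ennreal_cases ennreal_less_zero_iff infinity_ennreal_def not_less top.extremum)
  show "\<forall>\<^sub>F x in whp P. A (fst x) (D (fst x) (snd x)) (snd x) < e'"
    unfolding eventually_whp
  proof (intro allI impI)
    fix \<eta>' :: real assume "0 < \<eta>'"
    define \<eta> where "\<eta> = min \<eta>' 1 / 2"
    have \<eta>: "0 < \<eta>" "\<eta> < 1" "\<eta> + \<eta> \<le> \<eta>'" using \<open>0 < \<eta>'\<close> by (auto simp: \<eta>_def)
    have "\<forall>\<^sub>F x in whp P. (\<integral>\<^sup>+\<omega>. A (fst x) (D (fst x) (snd x)) \<omega> \<partial>P (fst x)) < ennreal (e * \<eta>)"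
      using e \<eta> by (intro order_tendstoD(2)[OF lim]) auto
    from this[unfolded eventually_whp, rule_format, OF \<open>0 < \<eta>\<close>]
    show "\<forall>\<^sub>F n in sequentially. \<exists>N\<in>sets (P n). measure (P n) N < \<eta>' \<and>
      (\<forall>\<omega>\<in>space (P n) - N. A (fst (n, \<omega>)) (D (fst (n, \<omega>)) (snd (n, \<omega>))) (snd (n, \<omega>)) < e')"
    proof (eventually_elim, elim bexE conjE)
      fix n N assume N: "N \<in> sets (P n)" "measure (P n) N < \<eta>"
        "\<forall>\<omega>\<in>space (P n) - N. (\<integral>\<^sup>+\<omega>'. A (fst (n, \<omega>)) (D (fst (n, \<omega>)) (snd (n, \<omega>))) \<omega>' \<partial>P (fst (n, \<omega>)))
          < ennreal (e * \<eta>)"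
      interpret prob_space "P n" by (rule P)
      obtain c where c: "prob {\<omega> \<in> space (P n). c < D n \<omega>} \<le> \<eta>"
          "\<eta> \<le> prob {\<omega> \<in> space (P n). c \<le> D n \<omega>}"
        using quantile[OF D \<eta>(1,2)] .
      have "\<not> {\<omega> \<in> space (P n). c \<le> D n \<omega>} \<subseteq> N"
        using c(2) N(1,2) finite_measure_mono[of "{\<omega> \<in> space (P n). c \<le> D n \<omega>}" N] by auto
      then obtain \<omega>\<^sub>0 where \<omega>\<^sub>0: "\<omega>\<^sub>0 \<in> space (P n) - N" "c \<le> D n \<omega>\<^sub>0" by auto
      define b where "b = max 0 c"
      have b: "0 \<le> b" "b \<le> D n \<omega>\<^sub>0" using \<omega>\<^sub>0 nonneg[of n \<omega>\<^sub>0] by (auto simp: b_def)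
      note [measurable] = A[OF b(1), of n]
      have "(\<integral>\<^sup>+\<omega>. A n b \<omega> \<partial>P n) \<le> (\<integral>\<^sup>+\<omega>. A n (D n \<omega>\<^sub>0) \<omega> \<partial>P n)"
        by (intro nn_integral_mono mono b)
      also have "\<dots> < ennreal (e * \<eta>)" using N(3) \<omega>\<^sub>0(1) by auto
      finally have markov: "prob {\<omega> \<in> space (P n). ennreal e \<le> A n b \<omega>} < \<eta>"
        using e \<eta> by (intro markov_ennreal) auto
      let ?N = "{\<omega> \<in> space (P n). c < D n \<omega>} \<union> {\<omega> \<in> space (P n). ennreal e \<le> A n b \<omega>}"
      have "prob ?N \<le> prob {\<omega> \<in> space (P n). c < D n \<omega>} + prob {\<omega> \<in> space (P n). ennreal e \<le> A n b \<omega>}"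
        by (rule measure_Un_le) measurable
      also have "\<dots> < \<eta>'" using c(1) markov \<eta>(3) by simp
      finally have "prob ?N < \<eta>'" .
      moreover have "A n (D n \<omega>) \<omega> < e'" if "\<omega> \<in> space (P n) - ?N" for \<omega>
      proof -
        have "A n (D n \<omega>) \<omega> \<le> A n b \<omega>"
          using that nonneg by (intro mono) (auto simp: b_def)
        also have "\<dots> < ennreal e" using that by auto
        also note e(2)
        finally show ?thesis .
      qed
      ultimately show "\<exists>N\<in>sets (P n). measure (P n) N < \<eta>' \<and>
        (\<forall>\<omega>\<in>space (P n) - N. A (fst (n, \<omega>)) (D (fst (n, \<omega>)) (snd (n, \<omega>))) (snd (n, \<omega>)) < e')"
        by (intro bexI[of _ ?N]) auto
    qed
  qed
qed auto

text \<open>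
The radius \<open>r\<close> may be an arbitrary function here: it is eventually below a deterministic \<open>b\<close>, chosen
so that the means at \<open>b\<close> are small, and only \<open>A n b\<close> is integrated. This generality serves the one-step
estimate, which is a random variable only on the event where it is defined.
\<close>

lemma vanishing_radius:
  fixes A :: "nat \<Rightarrow> real \<Rightarrow> 'w \<Rightarrow> ennreal"
  assumes P: "\<And>n. prob_space (P n)"
    and A[measurable]: "\<And>n r. 0 \<le> r \<Longrightarrow> A n r \<in> borel_measurable (P n)"
    and mono: "\<And>n r r' \<omega>. 0 \<le> r \<Longrightarrow> r \<le> r' \<Longrightarrow> A n r \<omega> \<le> A n r' \<omega>"
    and lim: "((\<lambda>r. limsup (\<lambda>n. \<integral>\<^sup>+\<omega>. A n r \<omega> \<partial>P n)) \<longlongrightarrow> 0) (at_right 0)"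
    and r: "(r \<longlongrightarrow> 0) (whp P)" "\<And>x. 0 \<le> r x"
  shows "((\<lambda>x. A (fst x) (r x) (snd x)) \<longlongrightarrow> 0) (whp P)"
proof (rule order_tendstoI)
  fix e' :: ennreal assume "0 < e'"
  then obtain e where e: "0 < e" "ennreal e < e'"
    by (metis dense ennreal_cases ennreal_less_zero_iff infinity_ennreal_def not_less top.extremum)
  show "\<forall>\<^sub>F x in whp P. A (fst x) (r x) (snd x) < e'"
    unfolding eventually_whp
  proof (intro allI impI)
    fix \<eta>' :: real assume "0 < \<eta>'"
    define \<eta> where "\<eta> = \<eta>' / 2"
    have \<eta>: "0 < \<eta>" using \<open>0 < \<eta>'\<close> by (auto simp: \<eta>_def)
    have "\<forall>\<^sub>F r in at_right 0. limsup (\<lambda>n. \<integral>\<^sup>+\<omega>. A n r \<omega> \<partial>P n) < ennreal (e * \<eta>)"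
      using e \<eta> by (intro order_tendstoD(2)[OF lim]) auto
    moreover have "\<forall>\<^sub>F r in at_right (0::real). 0 < r" by (rule eventually_at_right_less)
    ultimately obtain b where b: "0 < b" "limsup (\<lambda>n. \<integral>\<^sup>+\<omega>. A n b \<omega> \<partial>P n) < ennreal (e * \<eta>)"
      using eventually_happens'[OF _ eventually_conj]
      by (metis (mono_tags, lifting) trivial_limit_at_right_real)
    have "\<forall>\<^sub>F x in whp P. r x < b" using b r by (intro order_tendstoD(2)) auto
    from this[unfolded eventually_whp, rule_format, OF \<open>0 < \<eta>\<close>] Limsup_lessD[OF b(2)]
    show "\<forall>\<^sub>F n in sequentially. \<exists>N\<in>sets (P n). measure (P n) N < \<eta>' \<and>
      (\<forall>\<omega>\<in>space (P n) - N. A (fst (n, \<omega>)) (r (n, \<omega>)) (snd (n, \<omega>)) < e')"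
    proof (eventually_elim, elim bexE conjE)
      fix n N assume N: "N \<in> sets (P n)" "measure (P n) N < \<eta>" "\<forall>\<omega>\<in>space (P n) - N. r (n, \<omega>) < b"
        and less: "(\<integral>\<^sup>+\<omega>. A n b \<omega> \<partial>P n) < ennreal (e * \<eta>)"
      interpret prob_space "P n" by (rule P)
      note [measurable] = A[OF less_imp_le[OF b(1)], of n]
      have markov: "prob {\<omega> \<in> space (P n). ennreal e \<le> A n b \<omega>} < \<eta>"
        using e \<eta> less by (intro markov_ennreal) auto
      let ?N = "N \<union> {\<omega> \<in> space (P n). ennreal e \<le> A n b \<omega>}"
      have "prob ?N \<le> prob N + prob {\<omega> \<in> space (P n). ennreal e \<le> A n b \<omega>}"
        by (rule measure_Un_le[OF N(1)]) measurable
      also have "\<dots> < \<eta>'" using N(2) markov by (simp add: \<eta>_def)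
      finally have "prob ?N < \<eta>'" .
      moreover have "A n (r (n, \<omega>)) \<omega> < e'" if "\<omega> \<in> space (P n) - ?N" for \<omega>
      proof -
        have "A n (r (n, \<omega>)) \<omega> \<le> A n b \<omega>"
          using that N(3) r(2) by (intro mono) (auto intro: less_imp_le)
        also have "\<dots> < ennreal e" using that by auto
        also note e(2)
        finally show ?thesis .
      qed
      moreover have "?N \<in> sets (P n)" using N(1) by measurable
      ultimately show "\<exists>N\<in>sets (P n). measure (P n) N < \<eta>' \<and>
        (\<forall>\<omega>\<in>space (P n) - N. A (fst (n, \<omega>)) (r (n, \<omega>)) (snd (n, \<omega>)) < e')"
        by (intro bexI[of _ ?N]) auto
    qed
  qed
qed auto

section \<open>Taylor expansion with the modulus of the derivative\<close>

lemma tau_ge: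
  assumes "\<bar>t - \<theta>\<bar> \<le> \<delta>"
  shows "ennreal \<bar>g t - g \<theta>\<bar> \<le> tau \<Theta> \<theta> g \<delta>"
  using assms by (auto simp: tau_def intro: SUP_upper)

lemma tau_mono:
  assumes "\<delta> \<le> \<delta>'"
  shows "tau \<Theta> \<theta> g \<delta> \<le> tau \<Theta> \<theta> g \<delta>'"
proof (cases "{\<theta> - \<delta>'..\<theta> + \<delta>'} \<subseteq> \<Theta>")
  case True
  then have "{\<theta> - \<delta>..\<theta> + \<delta>} \<subseteq> \<Theta>" using assms by (meson atLeastatMost_subset_iff order_trans add_left_mono diff_left_mono)
  then show ?thesis using True assms by (auto simp: tau_def intro!: SUP_subset_mono)
qed (simp add: tau_def)

text \<open>
Both sides are extended reals so that no separate treatment of an infinite modulus, in particular of an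
interval that leaves \<open>\<Theta>\<close>, is needed in what follows: at \<open>t = \<theta>\<close> both sides are \<open>0\<close>, and
otherwise an infinite modulus makes the right-hand side infinite.
\<close>

lemma taylor_tau:
  fixes m m' :: "real \<Rightarrow> real"
  assumes int: "\<And>t1 t2. t1 < t2 \<Longrightarrow> {t1..t2} \<subseteq> \<Theta> \<Longrightarrow>
      has_bochner_integral (lebesgue_on {t1..t2}) m' (m t2 - m t1)"
    and t: "\<bar>t - \<theta>\<bar> \<le> \<delta>"
  shows "ennreal \<bar>m t - m \<theta> - (t - \<theta>) * m' \<theta>\<bar> \<le> ennreal \<bar>t - \<theta>\<bar> * tau \<Theta> \<theta> m' \<delta>"
proof (cases "t = \<theta>")
  case False
  show ?thesis
  proof (cases "tau \<Theta> \<theta> m' \<delta>")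
    case top
    then show ?thesis using False by (simp add: ennreal_mult_top)
  next
    case (real k)
    then have "{\<theta> - \<delta>..\<theta> + \<delta>} \<subseteq> \<Theta>" by (auto simp: tau_def split: if_splits)
    have bound: "\<bar>m' u - m' \<theta>\<bar> \<le> k" if "\<bar>u - \<theta>\<bar> \<le> \<delta>" for u
      using tau_ge[OF that, of m' \<Theta>] real by (simp add: ennreal_le_iff)
    have *: "\<bar>m b - m a - (b - a) * m' \<theta>\<bar> \<le> k * (b - a)"
      if "a < b" "{a..b} \<subseteq> {\<theta> - \<delta>..\<theta> + \<delta>}" for a b
    proof -
      have "has_bochner_integral (lebesgue_on {a..b}) m' (m b - m a)"
        using that \<open>{\<theta> - \<delta>..\<theta> + \<delta>} \<subseteq> \<Theta>\<close> by (intro int) auto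
      then have "(m' has_integral (m b - m a)) {a..b}"
        using has_integral_integral_lebesgue_on[of "{a..b}" m']
        by (auto simp: has_bochner_integral_iff)
      then have "((\<lambda>u. m' u - m' \<theta>) has_integral (m b - m a - (b - a) * m' \<theta>)) {a..b}"
        using has_integral_const_real[of "m' \<theta>" a b] that(1)
        by (intro has_integral_diff) (auto simp: mult.commute)
      then have "norm (m b - m a - (b - a) * m' \<theta>) \<le> k * measure lborel {a..b}"
        using real(1) that(2) by (intro has_integral_bound_real[where f = "\<lambda>u. m' u - m' \<theta>"]) (auto intro!: bound)
      then show ?thesis using that(1) by simp
    qed
    have "\<bar>m t - m \<theta> - (t - \<theta>) * m' \<theta>\<bar> \<le> k * \<bar>t - \<theta>\<bar>"
    proof (cases "\<theta> < t")
      case True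
      then show ?thesis using *[of \<theta> t] t by auto
    next
      case False
      then have "t < \<theta>" using \<open>t \<noteq> \<theta>\<close> by simp
      then have "\<bar>m \<theta> - m t - (\<theta> - t) * m' \<theta>\<bar> \<le> k * \<bar>t - \<theta>\<bar>"
        using *[of t \<theta>] t by auto
      moreover have "m t - m \<theta> - (t - \<theta>) * m' \<theta> = - (m \<theta> - m t - (\<theta> - t) * m' \<theta>)"
        by (simp add: algebra_simps)
      ultimately show ?thesis by simp
    qed
    then show ?thesis using real by (simp add: ennreal_mult[symmetric] mult.commute ennreal_leI)
  qed
qed simp

lemma taylor_tau_endpoint:
  fixes m m' :: "real \<Rightarrow> real"
  assumes int: "\<And>t1 t2. t1 < t2 \<Longrightarrow> {t1..t2} \<subseteq> \<Theta> \<Longrightarrow>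
      has_bochner_integral (lebesgue_on {t1..t2}) m' (m t2 - m t1)"
    and t: "\<bar>t - \<theta>\<bar> \<le> \<delta>"
  shows "ennreal \<bar>m t - m \<theta> - (t - \<theta>) * m' t\<bar> \<le> 2 * (ennreal \<bar>t - \<theta>\<bar> * tau \<Theta> \<theta> m' \<delta>)"
proof -
  have "m t - m \<theta> - (t - \<theta>) * m' t
      = (m t - m \<theta> - (t - \<theta>) * m' \<theta>) - (t - \<theta>) * (m' t - m' \<theta>)"
    by (simp add: algebra_simps)
  then have "\<bar>m t - m \<theta> - (t - \<theta>) * m' t\<bar>
      \<le> \<bar>m t - m \<theta> - (t - \<theta>) * m' \<theta>\<bar> + \<bar>t - \<theta>\<bar> * \<bar>m' t - m' \<theta>\<bar>"
    by (metis abs_mult abs_triangle_ineq4)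
  then have "ennreal \<bar>m t - m \<theta> - (t - \<theta>) * m' t\<bar>
      \<le> ennreal \<bar>m t - m \<theta> - (t - \<theta>) * m' \<theta>\<bar> + ennreal \<bar>t - \<theta>\<bar> * ennreal \<bar>m' t - m' \<theta>\<bar>"
    by (simp add: ennreal_mult[symmetric] ennreal_plus[symmetric] ennreal_leI del: ennreal_plus)
  also have "\<dots> \<le> ennreal \<bar>t - \<theta>\<bar> * tau \<Theta> \<theta> m' \<delta> + ennreal \<bar>t - \<theta>\<bar> * tau \<Theta> \<theta> m' \<delta>"
    by (intro add_mono taylor_tau int mult_left_mono tau_ge t) auto
  finally show ?thesis by (simp add: mult_2)
qed

lemma ennreal_abs_sum_le:
  fixes f :: "'i \<Rightarrow> real"
  assumes "\<And>i. i \<in> A \<Longrightarrow> ennreal \<bar>f i\<bar> \<le> F i"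
  shows "ennreal \<bar>sum f A\<bar> \<le> sum F A"
proof -
  have "ennreal \<bar>sum f A\<bar> \<le> ennreal (\<Sum>i\<in>A. \<bar>f i\<bar>)" by (intro ennreal_leI sum_abs)
  also have "\<dots> = (\<Sum>i\<in>A. ennreal \<bar>f i\<bar>)" by simp
  also have "\<dots> \<le> sum F A" by (intro sum_mono assms)
  finally show ?thesis .
qed

lemma borel_measurable_mono_ennreal:
  fixes f :: "real \<Rightarrow> ennreal"
  assumes "mono f"
  shows "f \<in> borel_measurable borel"
proof (rule borel_measurableI_greater)
  fix a
  have "is_interval {x. a < f x}"
    unfolding is_interval_1 using assms by (blast dest: monoD intro: less_le_trans)
  then show "{x \<in> space borel. a < f x} \<in> sets borel"
    by (simp add: real_interval_borel_measurable)
qed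

lemma ennreal_abs_divide_le:
  assumes "ennreal \<bar>a\<bar> \<le> R" "c \<noteq> 0"
  shows "ennreal \<bar>a / c\<bar> \<le> R / ennreal \<bar>c\<bar>"
  using divide_right_mono_ennreal[OF assms(1), of "ennreal \<bar>c\<bar>"] assms(2)
  by (simp add: divide_ennreal)

lemma ennreal_le_enn2real_divide:
  assumes "R / ennreal c < top" "0 < c"
  shows "R \<le> ennreal (enn2real (R / ennreal c) * c)"
proof (cases R)
  case (real a)
  then show ?thesis using assms(2) by (simp add: divide_ennreal)
next
  case top
  then show ?thesis using assms(1) by (simp add: ennreal_top_divide)
qed

section \<open>Expansions at a single sample point\<close>

text \<open>
The random sum whose mean appears in (R4) and (R5). A vanishing weight cancels an infinite modulus,
since \<open>0 * \<infinity> = 0\<close> for extended nonnegative reals.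
\<close>

definition weighted_modulus :: "nat \<Rightarrow> real set \<Rightarrow> real \<Rightarrow> real \<Rightarrow> (nat \<Rightarrow> real) \<Rightarrow> (nat \<Rightarrow> real) \<Rightarrow>
    (nat \<Rightarrow> real \<Rightarrow> real) \<Rightarrow> real \<Rightarrow> ennreal" where
  "weighted_modulus n \<Theta> \<theta> p c k m' \<delta> =
     (\<Sum>i=1..n. ennreal (\<bar>c i\<bar> + \<delta> powr p * k i) * tau \<Theta> \<theta> (m' i) \<delta>)"

lemma weighted_modulus_mono:
  assumes "0 < p" "\<And>i. i \<in> {1..n} \<Longrightarrow> 0 \<le> k i" "0 \<le> \<delta>" "\<delta> \<le> \<delta>'"
  shows "weighted_modulus n \<Theta> \<theta> p c k m' \<delta> \<le> weighted_modulus n \<Theta> \<theta> p c k m' \<delta>'"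
  unfolding weighted_modulus_def using assms
  by (intro sum_mono mult_mono[OF ennreal_leI tau_mono] add_left_mono mult_right_mono powr_mono2) auto

text \<open>
Everything random is frozen here: \<open>m i\<close> and \<open>m' i\<close> are the paths of \<open>M\<^sub>i\<close> and \<open>M\<^sub>i'\<close> at one sample
point of row \<open>n\<close>, and \<open>k i\<close> is the Hoelder constant of \<open>h\<^sub>i\<close>.
\<close>

locale sample_point =
  fixes n :: nat and \<Theta> :: "real set" and \<theta> p :: real and h m m' :: "nat \<Rightarrow> real \<Rightarrow> real"
    and k :: "nat \<Rightarrow> real"
  assumes p: "0 < p" and k: "\<And>i. i \<in> {1..n} \<Longrightarrow> 0 \<le> k i" and \<theta>: "\<theta> \<in> \<Theta>"
    and Hoelder: "\<And>i t1 t2. i \<in> {1..n} \<Longrightarrow> t1 \<in> \<Theta> \<Longrightarrow> t2 \<in> \<Theta> \<Longrightarrow>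
      \<bar>h i t1 - h i t2\<bar> \<le> k i * \<bar>t1 - t2\<bar> powr p"
    and int: "\<And>i t1 t2. i \<in> {1..n} \<Longrightarrow> t1 < t2 \<Longrightarrow> {t1..t2} \<subseteq> \<Theta> \<Longrightarrow>
      has_bochner_integral (lebesgue_on {t1..t2}) (m' i) (m i t2 - m i t1)"
begin

abbreviation R :: "real \<Rightarrow> ennreal" where
  "R \<equiv> weighted_modulus n \<Theta> \<theta> p (\<lambda>i. h i \<theta>) k m'"

lemma h_diff: "i \<in> {1..n} \<Longrightarrow> t \<in> \<Theta> \<Longrightarrow> \<bar>h i t - h i \<theta>\<bar> \<le> \<bar>t - \<theta>\<bar> powr p * k i"
  using Hoelder[of i t \<theta>] \<theta> by (simp add: mult.commute)

lemma h_bound: "i \<in> {1..n} \<Longrightarrow> t \<in> \<Theta> \<Longrightarrow> \<bar>h i t\<bar> \<le> \<bar>h i \<theta>\<bar> + \<bar>t - \<theta>\<bar> powr p * k i"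
  using h_diff[of i t] by linarith

text \<open>
The weight \<open>h i t\<close> differs from \<open>h i \<theta>\<close> by at most \<open>|t - \<theta>|\<^sup>p k i\<close>, which is why the weights of
\<open>weighted_modulus\<close> have the form they have. The multiplication takes place in the extended reals, so that indices with
weight \<open>0\<close> and infinite modulus do no harm.
\<close>

lemma weighted_le_R:
  assumes t: "t \<in> \<Theta>"
    and F: "\<And>i. i \<in> {1..n} \<Longrightarrow> ennreal \<bar>F i\<bar> \<le> c * tau \<Theta> \<theta> (m' i) \<bar>t - \<theta>\<bar>"
  shows "(\<Sum>i=1..n. ennreal \<bar>h i t * F i\<bar>) \<le> c * R \<bar>t - \<theta>\<bar>"
proof -
  have "(\<Sum>i=1..n. ennreal \<bar>h i t * F i\<bar>)
      \<le> (\<Sum>i=1..n. ennreal (\<bar>h i \<theta>\<bar> + \<bar>t - \<theta>\<bar> powr p * k i) * (c * tau \<Theta> \<theta> (m' i) \<bar>t - \<theta>\<bar>))"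
    using F h_bound[OF _ t] by (intro sum_mono) (auto simp: abs_mult ennreal_mult intro!: mult_mono ennreal_leI)
  then show ?thesis by (simp add: weighted_modulus_def sum_distrib_left mult_ac)
qed

lemma numerator_remainder:
  assumes t: "t \<in> \<Theta>"
  shows "ennreal \<bar>\<Sum>i=1..n. h i t * (m i t - m i \<theta> - (t - \<theta>) * m' i t)\<bar>
    \<le> 2 * (ennreal \<bar>t - \<theta>\<bar> * R \<bar>t - \<theta>\<bar>)"
proof -
  have "(\<Sum>i=1..n. ennreal \<bar>h i t * (m i t - m i \<theta> - (t - \<theta>) * m' i t)\<bar>)
      \<le> (2 * ennreal \<bar>t - \<theta>\<bar>) * R \<bar>t - \<theta>\<bar>"
    using taylor_tau_endpoint[OF int, where t = t and \<theta> = \<theta> and \<delta> = "\<bar>t - \<theta>\<bar>"]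
    by (intro weighted_le_R t) (simp add: mult.assoc)
  then show ?thesis
    by (intro order_trans[OF ennreal_abs_sum_le[OF order_refl]]) (simp add: mult.assoc)
qed

lemma derivative_remainder:
  assumes t: "t \<in> \<Theta>"
  shows "ennreal \<bar>\<Sum>i=1..n. h i t * (m' i t - m' i \<theta>)\<bar> \<le> R \<bar>t - \<theta>\<bar>"
proof -
  have "(\<Sum>i=1..n. ennreal \<bar>h i t * (m' i t - m' i \<theta>)\<bar>) \<le> 1 * R \<bar>t - \<theta>\<bar>"
    by (intro weighted_le_R t) (simp add: tau_ge)
  then show ?thesis
    by (intro order_trans[OF ennreal_abs_sum_le[OF order_refl]]) simp
qed

lemma weight_remainder:
  assumes t: "t \<in> \<Theta>"
  shows "\<bar>\<Sum>i=1..n. (h i t - h i \<theta>) * m' i \<theta>\<bar> \<le> \<bar>t - \<theta>\<bar> powr p * (\<Sum>i=1..n. k i * \<bar>m' i \<theta>\<bar>)"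
proof -
  have "\<bar>\<Sum>i=1..n. (h i t - h i \<theta>) * m' i \<theta>\<bar> \<le> (\<Sum>i=1..n. \<bar>(h i t - h i \<theta>) * m' i \<theta>\<bar>)"
    by (rule sum_abs)
  also have "\<dots> \<le> (\<Sum>i=1..n. \<bar>t - \<theta>\<bar> powr p * k i * \<bar>m' i \<theta>\<bar>)"
    using h_diff[OF _ t] by (intro sum_mono) (simp add: abs_mult mult_right_mono)
  finally show ?thesis by (simp add: sum_distrib_left mult.assoc)
qed

text \<open>
The two square roots are Euclidean norms of the vectors \<open>h i u * m i u\<close> at \<open>u = s\<close> and \<open>u = \<theta>\<close>. Their
difference splits into a change of weights, a linear term in \<open>s - \<theta>\<close> and the Taylor remainder. The
first two are matched by the last two conditions of (R7); for the third the Euclidean norm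
is replaced by the larger sum norm, to which the modulus bound applies.
\<close>

lemma norm_remainder:
  assumes s: "s \<in> \<Theta>" and close: "\<bar>s - \<theta>\<bar> \<le> 1" and l: "0 \<le> l" "R \<bar>s - \<theta>\<bar> \<le> ennreal l"
  shows "\<bar>sqrt (\<Sum>i=1..n. (h i s)\<^sup>2 * (m i s)\<^sup>2) - sqrt (\<Sum>i=1..n. (h i \<theta>)\<^sup>2 * (m i \<theta>)\<^sup>2)\<bar>
    \<le> \<bar>s - \<theta>\<bar> powr p * sqrt (\<Sum>i=1..n. (k i)\<^sup>2 * (m i \<theta>)\<^sup>2)
      + \<bar>s - \<theta>\<bar> * sqrt (2 * (\<Sum>i=1..n. ((k i)\<^sup>2 + (h i \<theta>)\<^sup>2) * (m' i \<theta>)\<^sup>2))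
      + \<bar>s - \<theta>\<bar> * l"
proof -
  let ?r = "\<bar>s - \<theta>\<bar>" and ?A = "{1..n}"
  define f where "f i = (h i s - h i \<theta>) * m i \<theta>" for i
  define g where "g i = h i s * ((s - \<theta>) * m' i \<theta>)" for i
  define e where "e i = h i s * (m i s - m i \<theta> - (s - \<theta>) * m' i \<theta>)" for i
  have sqrt_eq: "sqrt (\<Sum>i=1..n. (h i t)\<^sup>2 * (m i t)\<^sup>2) = L2_set (\<lambda>i. h i t * m i t) ?A" for t
    by (simp add: L2_set_def power_mult_distrib)
  have decomp: "h i s * m i s - h i \<theta> * m i \<theta> = f i + g i + e i" for i
    by (simp add: f_def g_def e_def algebra_simps)
  have tri: "L2_set u ?A \<le> L2_set v ?A + L2_set (\<lambda>i. u i - v i) ?A" for u v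
    using L2_set_triangle_ineq[of v "\<lambda>i. u i - v i" ?A] by simp
  have "\<bar>L2_set (\<lambda>i. h i s * m i s) ?A - L2_set (\<lambda>i. h i \<theta> * m i \<theta>) ?A\<bar>
      \<le> L2_set (\<lambda>i. h i s * m i s - h i \<theta> * m i \<theta>) ?A"
  proof -
    have "L2_set (\<lambda>i. h i \<theta> * m i \<theta> - h i s * m i s) ?A
        = L2_set (\<lambda>i. h i s * m i s - h i \<theta> * m i \<theta>) ?A"
      by (simp add: L2_set_def power2_commute)
    then show ?thesis
      using tri[of "\<lambda>i. h i s * m i s" "\<lambda>i. h i \<theta> * m i \<theta>"]
        tri[of "\<lambda>i. h i \<theta> * m i \<theta>" "\<lambda>i. h i s * m i s"] by linarith
  qed
  also have "\<dots> \<le> L2_set f ?A + L2_set g ?A + L2_set e ?A"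
    unfolding decomp
    by (intro order_trans[OF L2_set_triangle_ineq] add_mono L2_set_triangle_ineq order_refl)
  also have "L2_set f ?A \<le> ?r powr p * sqrt (\<Sum>i=1..n. (k i)\<^sup>2 * (m i \<theta>)\<^sup>2)"
  proof -
    have "L2_set f ?A = L2_set (\<lambda>i. \<bar>f i\<bar>) ?A" by (simp add: L2_set_def)
    also have "\<dots> \<le> L2_set (\<lambda>i. ?r powr p * (k i * \<bar>m i \<theta>\<bar>)) ?A"
      using h_diff[OF _ s] by (intro L2_set_mono) (auto simp: f_def abs_mult mult.assoc[symmetric] intro: mult_right_mono)
    also have "\<dots> = ?r powr p * L2_set (\<lambda>i. k i * \<bar>m i \<theta>\<bar>) ?A"
      by (simp add: L2_set_right_distrib)
    finally show ?thesis by (simp add: L2_set_def power_mult_distrib)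
  qed
  also have "L2_set g ?A \<le> ?r * sqrt (2 * (\<Sum>i=1..n. ((k i)\<^sup>2 + (h i \<theta>)\<^sup>2) * (m' i \<theta>)\<^sup>2))"
  proof -
    have "(g i)\<^sup>2 \<le> ?r\<^sup>2 * (2 * (((k i)\<^sup>2 + (h i \<theta>)\<^sup>2) * (m' i \<theta>)\<^sup>2))" if i: "i \<in> ?A" for i
    proof -
      have "?r powr p \<le> 1" using close p by (simp add: powr_le1)
      then have "?r powr p * k i \<le> 1 * k i" using k[OF i] by (intro mult_right_mono) auto
      then have "\<bar>h i s\<bar> \<le> \<bar>h i \<theta>\<bar> + k i" using h_bound[OF i s] by simp
      then have "(h i s)\<^sup>2 \<le> (\<bar>h i \<theta>\<bar> + k i)\<^sup>2" using k[OF i] by (simp add: abs_le_square_iff[symmetric])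
      also have "\<dots> \<le> 2 * ((k i)\<^sup>2 + (h i \<theta>)\<^sup>2)"
        using sum_squares_bound[of "\<bar>h i \<theta>\<bar>" "k i"] by (simp add: power2_sum)
      finally have "?r\<^sup>2 * (m' i \<theta>)\<^sup>2 * (h i s)\<^sup>2 \<le> ?r\<^sup>2 * (m' i \<theta>)\<^sup>2 * (2 * ((k i)\<^sup>2 + (h i \<theta>)\<^sup>2))"
        by (intro mult_left_mono) auto
      moreover have "(g i)\<^sup>2 = ?r\<^sup>2 * (m' i \<theta>)\<^sup>2 * (h i s)\<^sup>2" by (simp add: g_def power_mult_distrib)
      ultimately show ?thesis by (simp add: algebra_simps)
    qed
    then have "(\<Sum>i=1..n. (g i)\<^sup>2) \<le> ?r\<^sup>2 * (2 * (\<Sum>i=1..n. ((k i)\<^sup>2 + (h i \<theta>)\<^sup>2) * (m' i \<theta>)\<^sup>2))"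
      unfolding sum_distrib_left by (rule sum_mono)
    then have "L2_set g ?A \<le> sqrt (?r\<^sup>2 * (2 * (\<Sum>i=1..n. ((k i)\<^sup>2 + (h i \<theta>)\<^sup>2) * (m' i \<theta>)\<^sup>2)))"
      unfolding L2_set_def by (rule real_sqrt_le_mono)
    then show ?thesis by (simp add: real_sqrt_mult)
  qed
  also have "L2_set e ?A \<le> ?r * l"
  proof -
    have "(\<Sum>i=1..n. ennreal \<bar>e i\<bar>) \<le> ennreal ?r * R ?r"
      unfolding e_def
      using taylor_tau[OF int, where t = s and \<theta> = \<theta> and \<delta> = ?r] by (intro weighted_le_R s) simp
    also have "\<dots> \<le> ennreal ?r * ennreal l" by (intro mult_left_mono l) simp
    finally have "ennreal (\<Sum>i=1..n. \<bar>e i\<bar>) \<le> ennreal (?r * l)"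
      using l by (simp add: ennreal_mult)
    then have "(\<Sum>i=1..n. \<bar>e i\<bar>) \<le> ?r * l" using l by (simp add: ennreal_le_iff)
    then show ?thesis using L2_set_le_sum_abs[of e ?A] by linarith
  qed
  finally show ?thesis unfolding sqrt_eq by simp
qed

end

section \<open>Asymptotic normality of the studentized one-step estimator\<close>

text \<open>
The normalization \<open>|J|\<^sup>2\<^sup>p I\<^sup>1\<^sup>-\<^sup>p\<close> in (R7) is what remains when \<open>r\<^sup>p\<close> is measured in units of \<open>\<surd>I / |J|\<close>,
the order of magnitude of the estimation error.
\<close>

lemma powr_sqrt_rescale:
  fixes r S I J p :: real
  assumes "0 \<le> r" "0 \<le> S" "0 < I" "J \<noteq> 0"
  shows "r powr p * sqrt S / sqrt I
    = (r * \<bar>J\<bar> / sqrt I) powr p * sqrt (S / (\<bar>J\<bar> powr (2 * p) * I powr (1 - p)))"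
proof -
  have sqrtI: "sqrt I = I powr (1/2)" using assms by (simp add: powr_half_sqrt)
  have "sqrt (\<bar>J\<bar> powr (2 * p) * I powr (1 - p)) = (\<bar>J\<bar> powr (2 * p) * I powr (1 - p)) powr (1/2)"
    using assms by (simp add: powr_half_sqrt)
  also have "\<dots> = \<bar>J\<bar> powr p * I powr ((1 - p) / 2)"
    using assms by (simp add: powr_mult powr_powr)
  finally have den: "sqrt (S / (\<bar>J\<bar> powr (2 * p) * I powr (1 - p)))
      = sqrt S / (\<bar>J\<bar> powr p * I powr ((1 - p) / 2))"
    by (simp add: real_sqrt_divide)
  have num: "(r * \<bar>J\<bar> / sqrt I) powr p = r powr p * \<bar>J\<bar> powr p / I powr (p / 2)"
    unfolding sqrtI using assms by (simp only: powr_divide powr_mult powr_powr) simp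
  have I: "sqrt I = I powr (p / 2) * I powr ((1 - p) / 2)"
    unfolding sqrtI powr_add[symmetric] by (simp add: diff_divide_distrib)
  have eq: "x * s / (b * c) = (x * y / b) * (s / (y * c))" if "y \<noteq> 0" for x y s b c :: real
    using that by (simp add: divide_simps)
  show ?thesis
    unfolding den num unfolding I by (rule eq) (use assms(4) in simp)
qed

theorem mainTheorem2:
  fixes P :: "nat \<Rightarrow> 'w measure" and S :: "'x measure"
    and X :: "nat \<Rightarrow> nat \<Rightarrow> 'w \<Rightarrow> 'x"
    and \<Theta> :: "real set" and \<theta> p :: real
    and h :: "nat \<Rightarrow> nat \<Rightarrow> real \<Rightarrow> real" and hbar :: "nat \<Rightarrow> nat \<Rightarrow> real"
    and M M' :: "nat \<Rightarrow> nat \<Rightarrow> real \<Rightarrow> 'x \<Rightarrow> real"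
    and T :: "nat \<Rightarrow> (nat \<Rightarrow> 'x) \<Rightarrow> real"
    and I J :: "nat \<Rightarrow> real"
    and \<theta>s :: "nat \<Rightarrow> 'w \<Rightarrow> real" and \<tau>bar :: "nat \<Rightarrow> nat \<Rightarrow> real \<Rightarrow> ennreal"
    and \<theta>ss d :: "nat \<Rightarrow> 'w \<Rightarrow> real" and \<theta>ss_defined d_defined :: "nat \<Rightarrow> 'w \<Rightarrow> bool"
  defines "I \<equiv> I_nh P X h M \<theta>"
    and "J \<equiv> J_nh P X h M' \<theta>"
    and "\<tau>bar \<equiv> \<lambda>n i. tau_bar (P n) (X n i) \<Theta> \<theta> (M' n i)"
    and "\<theta>s \<equiv> \<lambda>n \<omega>. T n (sample X n \<omega>)"
    and "\<theta>ss \<equiv> \<lambda>n \<omega>. one_step n (h n) (M n) (M' n) (\<theta>s n \<omega>) (sample X n \<omega>)"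
    and "\<theta>ss_defined \<equiv> \<lambda>n \<omega>. one_step_defined \<Theta> n (h n) (M' n) (\<theta>s n \<omega>) (sample X n \<omega>)"
    and "d \<equiv> \<lambda>n \<omega>. d_star n (h n) (M n) (M' n) (\<theta>s n \<omega>) (sample X n \<omega>)"
    and "d_defined \<equiv> \<lambda>n \<omega>. d_star_defined \<Theta> n (h n) (M n) (M' n) (\<theta>s n \<omega>) (sample X n \<omega>)"
  assumes prob: "\<And>n. prob_space (P n)"
    and indep: "\<And>n. prob_space.indep_vars (P n) (\<lambda>_. S) (X n) {1..n}"
    and Theta: "open \<Theta>" "\<theta> \<in> \<Theta>"
    and hbar_nonneg: "\<And>n i. i \<in> {1..n} \<Longrightarrow> 0 \<le> hbar n i"
    and T_statistic: "\<And>n. T n \<in> borel_measurable (\<Pi>\<^sub>M i\<in>{1..n}. S)"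
    and consistent: "tendsto_prob P \<theta>s \<theta>"
    \<comment> \<open>measurability that is implicit in speaking of random variables, expectations, distributions\<close>
    and M_measurable: "\<And>n i t. i \<in> {1..n} \<Longrightarrow> t \<in> \<Theta> \<Longrightarrow> M n i t \<in> borel_measurable S"
    and M'_measurable: "\<And>n i t. i \<in> {1..n} \<Longrightarrow> t \<in> \<Theta> \<Longrightarrow> M' n i t \<in> borel_measurable S"
    and tau_measurable: "\<And>n i \<delta>. i \<in> {1..n} \<Longrightarrow> 0 \<le> \<delta> \<Longrightarrow>
          (\<lambda>\<omega>. tau \<Theta> \<theta> (\<lambda>t. M' n i t (X n i \<omega>)) \<delta>) \<in> borel_measurable (P n)"
    and \<theta>ss_statistic: "\<And>n. rand_var_on (P n) (\<theta>ss_defined n) (\<theta>ss n)"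
    and d_statistic: "\<And>n. rand_var_on (P n) (d_defined n) (d n)"
    \<comment> \<open>(R2)\<close>
    and R2_integral: "\<And>n. AE \<omega> in P n. \<forall>i\<in>{1..n}. \<forall>t1 t2. t1 < t2 \<and> {t1..t2} \<subseteq> \<Theta> \<longrightarrow>
          has_bochner_integral (lebesgue_on {t1..t2}) (\<lambda>t. M' n i t (X n i \<omega>))
            (M n i t2 (X n i \<omega>) - M n i t1 (X n i \<omega>))"
    and R2_mean: "\<And>n i. i \<in> {1..n} \<Longrightarrow> integral\<^sup>L (P n) (\<lambda>\<omega>. M n i \<theta> (X n i \<omega>)) = 0"
    and R2_second_moment: "\<And>n i. i \<in> {1..n} \<Longrightarrow> integrable (P n) (\<lambda>\<omega>. (M n i \<theta> (X n i \<omega>))\<^sup>2)"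
    and R2_first_moment: "\<And>n i. i \<in> {1..n} \<Longrightarrow> integrable (P n) (\<lambda>\<omega>. M' n i \<theta> (X n i \<omega>))"
    and R2_p: "0 < p" "p \<le> 1"
    and R2_Hoelder: "\<And>n i t1 t2. i \<in> {1..n} \<Longrightarrow> t1 \<in> \<Theta> \<Longrightarrow> t2 \<in> \<Theta> \<Longrightarrow>
          \<bar>h n i t1 - h n i t2\<bar> \<le> hbar n i * \<bar>t1 - t2\<bar> powr p"
    \<comment> \<open>(R3)\<close>
    and R3_nonzero: "\<forall>\<^sub>F n in sequentially. I n > 0 \<and> J n \<noteq> 0"
    and R3_ratio: "filterlim (\<lambda>n. \<bar>J n\<bar> / sqrt (I n)) at_top sequentially"
    and R3_lln: "tendsto_prob P (\<lambda>n \<omega>. (\<Sum>i=1..n. h n i \<theta> * M' n i \<theta> (X n i \<omega>)) / J n) 1"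
    and R3_clt: "weak_conv_m
          (\<lambda>n. distr (P n) borel (\<lambda>\<omega>. (\<Sum>i=1..n. h n i \<theta> * M n i \<theta> (X n i \<omega>)) / sqrt (I n)))
          std_normal_distribution"
    \<comment> \<open>(R4)\<close>
    and R4: "((\<lambda>\<delta>. limsup (\<lambda>n.
          (\<Sum>i=1..n. ennreal (\<bar>h n i \<theta>\<bar> + \<delta> powr p * hbar n i) * \<tau>bar n i \<delta>) / ennreal \<bar>J n\<bar>))
          \<longlongrightarrow> 0) (at_right 0)"
    \<comment> \<open>(R5)\<close>
    and R5_first: "tendsto_prob_zero_ennreal P (\<lambda>n \<omega>. ennreal \<bar>\<theta>s n \<omega> - \<theta>\<bar> *
          (\<Sum>i=1..n. ennreal (hbar n i * \<bar>\<theta>s n \<omega> - \<theta>\<bar> powr p + \<bar>h n i \<theta>\<bar>)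
             * \<tau>bar n i \<bar>\<theta>s n \<omega> - \<theta>\<bar>) / ennreal (sqrt (I n)))"
    and R5_second: "tendsto_prob P (\<lambda>n \<omega>. \<bar>\<theta>s n \<omega> - \<theta>\<bar> powr p *
          (\<Sum>i=1..n. hbar n i * integral\<^sup>L (P n) (\<lambda>\<omega>'. \<bar>M' n i \<theta> (X n i \<omega>')\<bar>)) / \<bar>J n\<bar>) 0"
    \<comment> \<open>(R6); \<open>h n i (\<theta>s n \<omega>)\<close> is defined only when \<open>\<theta>s n \<omega> \<in> \<Theta>\<close>, an event of probability
        tending to \<open>1\<close>\<close>
    and R6: "tendsto_prob P (\<lambda>n \<omega>. if \<theta>s n \<omega> \<in> \<Theta>
          then (\<Sum>i=1..n. (h n i (\<theta>s n \<omega>) - h n i \<theta>) * M n i \<theta> (X n i \<omega>)) / sqrt (I n)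
          else 0) 0"
    \<comment> \<open>(R7)\<close>
    and R7_first: "tendsto_prob P
          (\<lambda>n \<omega>. (\<Sum>i=1..n. (h n i \<theta>)\<^sup>2 * (M n i \<theta> (X n i \<omega>))\<^sup>2) / I n) 1"
    and R7_second: "tendsto_prob P
          (\<lambda>n \<omega>. (\<Sum>i=1..n. ((hbar n i)\<^sup>2 + (h n i \<theta>)\<^sup>2) * (M' n i \<theta> (X n i \<omega>))\<^sup>2) / (J n)\<^sup>2) 0"
    and R7_third: "tendsto_prob P
          (\<lambda>n \<omega>. (\<Sum>i=1..n. (hbar n i)\<^sup>2 * (M n i \<theta> (X n i \<omega>))\<^sup>2)
             / (\<bar>J n\<bar> powr (2 * p) * I n powr (1 - p))) 0"
  shows "(\<lambda>n. measure (P n) {\<omega> \<in> space (P n). d_defined n \<omega>}) \<longlonglongrightarrow> 1 \<and>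
    weak_conv_m
      (\<lambda>n. distr (P n) borel (\<lambda>\<omega>. if d_defined n \<omega> then d n \<omega> * (\<theta>ss n \<omega> - \<theta>) else 0))
      std_normal_distribution"
proof -
  interpret P: prob_space "P n" for n by (rule prob)
  have X_meas: "X n i \<in> measurable (P n) S" if "i \<in> {1..n}" for n i
    using indep[of n] that unfolding prob_space.indep_vars_def2[OF prob] by blast
  have "sample X n \<in> measurable (P n) (\<Pi>\<^sub>M i\<in>{1..n}. S)" for n
    unfolding sample_def[abs_def] using X_meas by (intro measurable_restrict) auto
  then have \<theta>s_meas[measurable]: "\<theta>s n \<in> borel_measurable (P n)" for n
    unfolding \<theta>s_def using T_statistic by (rule measurable_compose)
  have M_meas: "(\<lambda>\<omega>. M n i t (X n i \<omega>)) \<in> borel_measurable (P n)"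
    and M'_meas: "(\<lambda>\<omega>. M' n i t (X n i \<omega>)) \<in> borel_measurable (P n)"
    if "i \<in> {1..n}" "t \<in> \<Theta>" for n i t
    using measurable_compose[OF X_meas M_measurable] measurable_compose[OF X_meas M'_measurable] that
    by blast+
  have \<Theta>_borel[measurable]: "\<Theta> \<in> sets borel" using Theta(1) by simp
  have h_cont: "continuous_on \<Theta> (h n i)" if i: "i \<in> {1..n}" for n i
    unfolding continuous_on_def
  proof
    fix t assume t: "t \<in> \<Theta>"
    have "((\<lambda>u. hbar n i * \<bar>u - t\<bar> powr p) \<longlongrightarrow> hbar n i * \<bar>t - t\<bar> powr p) (at t within \<Theta>)"
      using R2_p(1)
      by (intro tendsto_mult tendsto_const tendsto_powr2 tendsto_rabs tendsto_diff tendsto_ident_at) simp_all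
    then have null: "((\<lambda>u. hbar n i * \<bar>u - t\<bar> powr p) \<longlongrightarrow> 0) (at t within \<Theta>)" by simp
    have "\<forall>\<^sub>F u in at t within \<Theta>. norm (h n i u - h n i t) \<le> hbar n i * \<bar>u - t\<bar> powr p"
      unfolding eventually_at_filter real_norm_def
      by (intro always_eventually allI impI R2_Hoelder[OF i _ t])
    from Lim_null_comparison[OF this null]
    show "(h n i \<longlongrightarrow> h n i t) (at t within \<Theta>)" by (rule LIM_zero_cancel)
  qed
  define L where "L n \<delta> \<omega> =
    weighted_modulus n \<Theta> \<theta> p (\<lambda>i. h n i \<theta>) (hbar n) (\<lambda>i t. M' n i t (X n i \<omega>)) \<delta>" for n \<delta> \<omega>
  have L_meas: "L n \<delta> \<in> borel_measurable (P n)" if "0 \<le> \<delta>" for n \<delta>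
    unfolding L_def weighted_modulus_def
    using tau_measurable[OF _ that] by (intro borel_measurable_sum borel_measurable_times) auto
  have L_mono: "L n \<delta> \<omega> \<le> L n \<delta>' \<omega>" if "0 \<le> \<delta>" "\<delta> \<le> \<delta>'" for n \<delta> \<delta>' \<omega>
    unfolding L_def using that R2_p hbar_nonneg by (intro weighted_modulus_mono) auto
  have L_int: "(\<integral>\<^sup>+\<omega>. L n \<delta> \<omega> \<partial>P n)
      = (\<Sum>i=1..n. ennreal (\<bar>h n i \<theta>\<bar> + \<delta> powr p * hbar n i) * \<tau>bar n i \<delta>)" if "0 \<le> \<delta>" for n \<delta>
    unfolding L_def weighted_modulus_def \<tau>bar_def tau_bar_def using tau_measurable[OF _ that]
    by (subst nn_integral_sum) (auto intro!: sum.cong nn_integral_cmult borel_measurable_times)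

  define D where "D n \<omega> = \<bar>\<theta>s n \<omega> - \<theta>\<bar>" for n \<omega>
  have D_meas[measurable]: "D n \<in> borel_measurable (P n)" for n
    unfolding D_def[abs_def] by measurable
  have D_nonneg: "0 \<le> D n \<omega>" for n \<omega> by (simp add: D_def)
  have \<theta>s_lim: "((\<lambda>x. \<theta>s (fst x) (snd x)) \<longlongrightarrow> \<theta>) (whp P)"
    using consistent by (rule tendsto_whp_of_tendsto_prob) simp
  then have D_lim: "((\<lambda>x. D (fst x) (snd x)) \<longlongrightarrow> 0) (whp P)"
    unfolding D_def by (intro tendsto_rabs_zero LIM_zero)

  \<comment> \<open>(R4) says that the mean of \<open>L n \<delta> / |J|\<close> vanishes as \<open>n\<close> grows and then \<open>\<delta>\<close> shrinks.
    It serves for both radii, \<open>|\<theta>s - \<theta>|\<close> and \<open>|\<theta>ss - \<theta>|\<close>.\<close>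
  have L_vanish: "((\<lambda>x. L (fst x) (r x) (snd x) / ennreal \<bar>J (fst x)\<bar>) \<longlongrightarrow> 0) (whp P)"
    if r: "(r \<longlongrightarrow> 0) (whp P)" "\<And>x. 0 \<le> r x" for r
  proof (rule vanishing_radius[where A = "\<lambda>n \<delta> \<omega>. L n \<delta> \<omega> / ennreal \<bar>J n\<bar>", OF prob _ _ _ r])
    show "(\<lambda>\<omega>. L n \<delta> \<omega> / ennreal \<bar>J n\<bar>) \<in> borel_measurable (P n)" if "0 \<le> \<delta>" for n \<delta>
      using L_meas[OF that] by measurable
    show "L n \<delta> \<omega> / ennreal \<bar>J n\<bar> \<le> L n \<delta>' \<omega> / ennreal \<bar>J n\<bar>"
      if "0 \<le> \<delta>" "\<delta> \<le> \<delta>'" for n \<delta> \<delta>' \<omega>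
      by (intro divide_right_mono_ennreal L_mono that)
    have "\<forall>\<^sub>F \<delta> in at_right 0. limsup (\<lambda>n.
        (\<Sum>i=1..n. ennreal (\<bar>h n i \<theta>\<bar> + \<delta> powr p * hbar n i) * \<tau>bar n i \<delta>) / ennreal \<bar>J n\<bar>)
        = limsup (\<lambda>n. \<integral>\<^sup>+\<omega>. L n \<delta> \<omega> / ennreal \<bar>J n\<bar> \<partial>P n)"
      using eventually_at_right_less[of "0::real"]
      by eventually_elim (simp add: nn_integral_divide L_meas L_int)
    with R4 show "((\<lambda>\<delta>. limsup (\<lambda>n. \<integral>\<^sup>+\<omega>. L n \<delta> \<omega> / ennreal \<bar>J n\<bar> \<partial>P n)) \<longlongrightarrow> 0) (at_right 0)"
      by (rule Lim_transform_eventually)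
  qed

  \<comment> \<open>(R5) passes from the averaged modulus to the modulus of the sample itself.\<close>
  have R5_first': "((\<lambda>x. ennreal (D (fst x) (snd x)) * L (fst x) (D (fst x) (snd x)) (snd x)
      / ennreal (sqrt (I (fst x)))) \<longlongrightarrow> 0) (whp P)"
  proof (rule random_radius[where D = D and A = "\<lambda>n \<delta> \<omega>. ennreal \<delta> * L n \<delta> \<omega> / ennreal (sqrt (I n))",
        OF prob D_meas D_nonneg])
    show "(\<lambda>\<omega>. ennreal \<delta> * L n \<delta> \<omega> / ennreal (sqrt (I n))) \<in> borel_measurable (P n)" if "0 \<le> \<delta>" for n \<delta>
      using L_meas[OF that] by measurable
    show "ennreal \<delta> * L n \<delta> \<omega> / ennreal (sqrt (I n)) \<le> ennreal \<delta>' * L n \<delta>' \<omega> / ennreal (sqrt (I n))"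
      if "0 \<le> \<delta>" "\<delta> \<le> \<delta>'" for n \<delta> \<delta>' \<omega>
      using that by (intro divide_right_mono_ennreal mult_mono L_mono ennreal_leI) auto
    have int: "(\<integral>\<^sup>+\<omega>. ennreal \<delta> * L n \<delta> \<omega> / ennreal (sqrt (I n)) \<partial>P n) = ennreal \<delta> *
        (\<Sum>i=1..n. ennreal (\<bar>h n i \<theta>\<bar> + \<delta> powr p * hbar n i) * \<tau>bar n i \<delta>) / ennreal (sqrt (I n))"
      if "0 \<le> \<delta>" for n \<delta>
      using L_meas[OF that, of n]
      by (subst nn_integral_divide) (simp_all add: nn_integral_cmult L_int[OF that])
    \<comment> \<open>Monotonicity of \<open>\<tau>bar n i\<close> turns the expression in (R5) into a random variable.\<close>
    have [measurable]: "\<tau>bar n i \<in> borel_measurable borel" for n i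
      unfolding \<tau>bar_def tau_bar_def
      by (intro borel_measurable_mono_ennreal monoI nn_integral_mono tau_mono)
    have "((\<lambda>x. ennreal \<bar>\<theta>s (fst x) (snd x) - \<theta>\<bar> *
          (\<Sum>i=1..fst x. ennreal (hbar (fst x) i * \<bar>\<theta>s (fst x) (snd x) - \<theta>\<bar> powr p + \<bar>h (fst x) i \<theta>\<bar>)
             * \<tau>bar (fst x) i \<bar>\<theta>s (fst x) (snd x) - \<theta>\<bar>) / ennreal (sqrt (I (fst x)))) \<longlongrightarrow> 0) (whp P)"
      by (rule tendsto_whp_of_tendsto_prob_ennreal[OF R5_first]) measurable
    then show "((\<lambda>x. \<integral>\<^sup>+\<omega>. ennreal (D (fst x) (snd x)) * L (fst x) (D (fst x) (snd x)) \<omega>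
        / ennreal (sqrt (I (fst x))) \<partial>P (fst x)) \<longlongrightarrow> 0) (whp P)"
      unfolding int[OF D_nonneg] unfolding D_def by (simp only: add.commute mult.commute[of "hbar _ _"])
  qed

  have J_I: "\<forall>\<^sub>F x in whp P. 0 < I (fst x) \<and> J (fst x) \<noteq> 0"
    using R3_nonzero by (rule whp_sequentially)

  \<comment> \<open>Likewise for the second half of (R5), with the modulus \<open>\<delta>\<^sup>p\<close> times the sum of the \<open>hbar * |M'|\<close>.\<close>
  have hM'_lim: "((\<lambda>x. D (fst x) (snd x) powr p *
      (\<Sum>i=1..fst x. hbar (fst x) i * \<bar>M' (fst x) i \<theta> (X (fst x) i (snd x))\<bar>) / \<bar>J (fst x)\<bar>) \<longlongrightarrow> 0) (whp P)"
  proof -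
    have sum_meas: "(\<lambda>\<omega>. \<Sum>i=1..n. hbar n i * \<bar>M' n i \<theta> (X n i \<omega>)\<bar>) \<in> borel_measurable (P n)" for n
      using M'_meas[OF _ Theta(2)] by (intro borel_measurable_sum borel_measurable_times) auto
    have weight_nonneg: "0 \<le> (\<Sum>i=1..n. hbar n i * \<bar>M' n i \<theta> (X n i \<omega>)\<bar>)" for n \<omega>
      using hbar_nonneg by (intro sum_nonneg mult_nonneg_nonneg) auto
    have int: "(\<integral>\<^sup>+\<omega>. ennreal (\<delta> powr p * (\<Sum>i=1..n. hbar n i * \<bar>M' n i \<theta> (X n i \<omega>)\<bar>) / \<bar>J n\<bar>) \<partial>P n)
        = ennreal (\<delta> powr p * (\<Sum>i=1..n. hbar n i * (\<integral>\<omega>. \<bar>M' n i \<theta> (X n i \<omega>)\<bar> \<partial>P n)) / \<bar>J n\<bar>)" for n \<delta>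
      using R2_first_moment weight_nonneg
      by (subst nn_integral_eq_integral) (auto intro!: integrable_sum integrable_mult_right integrable_divide)
    have "((\<lambda>x. ennreal (D (fst x) (snd x) powr p *
        (\<Sum>i=1..fst x. hbar (fst x) i * \<bar>M' (fst x) i \<theta> (X (fst x) i (snd x))\<bar>) / \<bar>J (fst x)\<bar>)) \<longlongrightarrow> 0) (whp P)"
    proof (rule random_radius[where D = D and A = "\<lambda>n \<delta> \<omega>. ennreal (\<delta> powr p *
        (\<Sum>i=1..n. hbar n i * \<bar>M' n i \<theta> (X n i \<omega>)\<bar>) / \<bar>J n\<bar>)", OF prob D_meas D_nonneg])
      show "(\<lambda>\<omega>. ennreal (\<delta> powr p * (\<Sum>i=1..n. hbar n i * \<bar>M' n i \<theta> (X n i \<omega>)\<bar>) / \<bar>J n\<bar>))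
          \<in> borel_measurable (P n)" for n \<delta>
        using sum_meas[of n] by measurable
      show "ennreal (\<delta> powr p * (\<Sum>i=1..n. hbar n i * \<bar>M' n i \<theta> (X n i \<omega>)\<bar>) / \<bar>J n\<bar>)
          \<le> ennreal (\<delta>' powr p * (\<Sum>i=1..n. hbar n i * \<bar>M' n i \<theta> (X n i \<omega>)\<bar>) / \<bar>J n\<bar>)"
        if "0 \<le> \<delta>" "\<delta> \<le> \<delta>'" for n \<delta> \<delta>' \<omega>
        using that R2_p weight_nonneg by (intro ennreal_leI divide_right_mono mult_right_mono powr_mono2) auto
      have "((\<lambda>x. \<bar>\<theta>s (fst x) (snd x) - \<theta>\<bar> powr p * (\<Sum>i=1..fst x. hbar (fst x) i *
          integral\<^sup>L (P (fst x)) (\<lambda>\<omega>'. \<bar>M' (fst x) i \<theta> (X (fst x) i \<omega>')\<bar>)) / \<bar>J (fst x)\<bar>) \<longlongrightarrow> 0) (whp P)"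
        by (rule tendsto_whp_of_tendsto_prob[OF R5_second]) measurable
      then show "((\<lambda>x. \<integral>\<^sup>+\<omega>. ennreal (D (fst x) (snd x) powr p *
          (\<Sum>i=1..fst x. hbar (fst x) i * \<bar>M' (fst x) i \<theta> (X (fst x) i \<omega>)\<bar>) / \<bar>J (fst x)\<bar>) \<partial>P (fst x))
          \<longlongrightarrow> 0) (whp P)"
        unfolding int D_def using tendsto_ennrealI by fastforce
    qed
    then show ?thesis
      by (rule tendsto_0_ennreal_comparison)
        (intro always_eventually allI eq_refl arg_cong[of _ _ ennreal] abs_of_nonneg divide_nonneg_nonneg
          mult_nonneg_nonneg powr_ge_zero weight_nonneg abs_ge_zero)
  qed
  define t where "t x = \<theta>s (fst x) (snd x)" for x
  define H where "H x = (\<Sum>i=1..fst x. h (fst x) i (t x) * M' (fst x) i (t x) (X (fst x) i (snd x)))" for x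
  define G where "G x = (\<Sum>i=1..fst x. h (fst x) i (t x) * M (fst x) i (t x) (X (fst x) i (snd x)))" for x
  define s where "s x = t x - G x / H x" for x
  define Z where "Z n \<omega> = (\<Sum>i=1..n. h n i \<theta> * M n i \<theta> (X n i \<omega>)) / sqrt (I n)" for n \<omega>
  define N where "N u x = sqrt (\<Sum>i=1..fst x. (h (fst x) i u)\<^sup>2 * (M (fst x) i u (X (fst x) i (snd x)))\<^sup>2)" for u x

  have \<theta>ss_eq: "\<theta>ss (fst x) (snd x) = s x" for x
    unfolding \<theta>ss_def one_step_def s_def G_def H_def t_def by (simp add: sample_def cong: sum.cong_simp)
  have \<theta>ss_defined_iff: "\<theta>ss_defined (fst x) (snd x) \<longleftrightarrow> t x \<in> \<Theta> \<and> H x \<noteq> 0" for x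
    unfolding \<theta>ss_defined_def one_step_defined_def H_def t_def by (simp add: sample_def cong: sum.cong_simp)
  have d_eq: "d (fst x) (snd x) = H x / N (s x) x" for x
    using \<theta>ss_eq[of x] unfolding \<theta>ss_def d_def d_star_def Let_def H_def t_def N_def
    by (simp add: sample_def cong: sum.cong_simp)
  have d_defined_iff: "d_defined (fst x) (snd x) \<longleftrightarrow> t x \<in> \<Theta> \<and> H x \<noteq> 0 \<and> s x \<in> \<Theta> \<and> N (s x) x \<noteq> 0" for x
    using \<theta>ss_eq[of x] \<theta>ss_defined_iff[of x]
    unfolding \<theta>ss_def \<theta>ss_defined_def d_defined_def d_star_defined_def Let_def N_def
    by (simp add: sample_def cong: sum.cong_simp)

  have good: "\<forall>\<^sub>F x in whp P. sample_point (fst x) \<Theta> \<theta> p (h (fst x))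
      (\<lambda>i t. M (fst x) i t (X (fst x) i (snd x))) (\<lambda>i t. M' (fst x) i t (X (fst x) i (snd x))) (hbar (fst x))"
    using whp_AE[OF R2_integral]
    by eventually_elim (use R2_p hbar_nonneg Theta R2_Hoelder in \<open>unfold_locales, auto\<close>)
  have t_lim: "(t \<longlongrightarrow> \<theta>) (whp P)" using \<theta>s_lim by (simp add: t_def[abs_def])
  have t_in: "\<forall>\<^sub>F x in whp P. t x \<in> \<Theta>" by (rule topological_tendstoD[OF t_lim Theta])

  \<comment> \<open>Replace first \<open>M'(t)\<close> by \<open>M'(\<theta>)\<close>, at the cost of (R4), then \<open>h(t)\<close> by \<open>h(\<theta>)\<close>, at the cost of (R5).\<close>
  have B_lim: "((\<lambda>x. H x / J (fst x)) \<longlongrightarrow> 1) (whp P)"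
  proof -
    define b0 where "b0 x = (\<Sum>i=1..fst x. h (fst x) i \<theta> * M' (fst x) i \<theta> (X (fst x) i (snd x))) / J (fst x)" for x
    define b1 where "b1 x = (\<Sum>i=1..fst x. h (fst x) i (t x) * (M' (fst x) i (t x) (X (fst x) i (snd x))
      - M' (fst x) i \<theta> (X (fst x) i (snd x)))) / J (fst x)" for x
    define b2 where "b2 x = (\<Sum>i=1..fst x. (h (fst x) i (t x) - h (fst x) i \<theta>)
      * M' (fst x) i \<theta> (X (fst x) i (snd x))) / J (fst x)" for x
    have "(b0 \<longlongrightarrow> 1) (whp P)"
      unfolding b0_def using M'_meas[OF _ Theta(2)]
      by (intro tendsto_whp_of_tendsto_prob[OF R3_lln] borel_measurable_divide borel_measurable_sum
          borel_measurable_times) auto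
    moreover have "(b1 \<longlongrightarrow> 0) (whp P)"
    proof (rule tendsto_0_ennreal_comparison[OF L_vanish[OF D_lim D_nonneg]])
      show "\<forall>\<^sub>F x in whp P. ennreal \<bar>b1 x\<bar> \<le> L (fst x) (D (fst x) (snd x)) (snd x) / ennreal \<bar>J (fst x)\<bar>"
        using good t_in J_I
      proof eventually_elim
        case (elim x)
        show ?case unfolding b1_def L_def D_def t_def[symmetric]
          using elim by (intro ennreal_abs_divide_le sample_point.derivative_remainder[OF elim(1)]) auto
      qed
    qed
    moreover have "(b2 \<longlongrightarrow> 0) (whp P)"
    proof (rule Lim_null_comparison[OF _ hM'_lim])
      show "\<forall>\<^sub>F x in whp P. norm (b2 x) \<le> D (fst x) (snd x) powr p *
          (\<Sum>i=1..fst x. hbar (fst x) i * \<bar>M' (fst x) i \<theta> (X (fst x) i (snd x))\<bar>) / \<bar>J (fst x)\<bar>"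
        using good t_in J_I
      proof eventually_elim
        case (elim x)
        show ?case unfolding b2_def D_def t_def[symmetric] real_norm_def abs_divide
          by (intro divide_right_mono sample_point.weight_remainder[OF elim(1,2)]) simp
      qed
    qed
    ultimately have "((\<lambda>x. b0 x + b1 x + b2 x) \<longlongrightarrow> 1 + 0 + 0) (whp P)"
      by (intro tendsto_add)
    moreover have "b0 x + b1 x + b2 x = H x / J (fst x)" for x
      unfolding b0_def b1_def b2_def H_def add_divide_distrib[symmetric] sum.distrib[symmetric]
      by (simp add: algebra_simps)
    ultimately show ?thesis by simp
  qed
  have H_nz: "\<forall>\<^sub>F x in whp P. H x \<noteq> 0"
    using tendsto_imp_eventually_ne[OF B_lim, of 0] by (auto elim: eventually_mono)

  \<comment> \<open>\<open>E\<close> collects the change of weights, covered by (R6), and the Taylor remainder, covered by (R5).\<close>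
  define E where "E x = (G x - (t x - \<theta>) * H x) / sqrt (I (fst x)) - Z (fst x) (snd x)" for x
  have E_lim: "(E \<longlongrightarrow> 0) (whp P)"
  proof -
    define e1 where "e1 n \<omega> = (if \<theta>s n \<omega> \<in> \<Theta> then (\<Sum>i=1..n. (h n i (\<theta>s n \<omega>) - h n i \<theta>)
      * M n i \<theta> (X n i \<omega>)) / sqrt (I n) else 0)" for n \<omega>
    define e2 where "e2 x = (\<Sum>i=1..fst x. h (fst x) i (t x) * (M (fst x) i (t x) (X (fst x) i (snd x))
      - M (fst x) i \<theta> (X (fst x) i (snd x)) - (t x - \<theta>) * M' (fst x) i (t x) (X (fst x) i (snd x))))
      / sqrt (I (fst x))" for x
    have "((\<lambda>x. e1 (fst x) (snd x)) \<longlongrightarrow> 0) (whp P)"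
      unfolding e1_def
    proof (rule tendsto_whp_of_tendsto_prob[OF R6])
      fix n
      \<comment> \<open>Hoelder continuity makes \<open>h n i\<close> Borel on \<open>\<Theta>\<close>; outside \<open>\<Theta>\<close> its values are arbitrary.\<close>
      define g where "g i u = (if u \<in> \<Theta> then h n i u else 0)" for i u
      have [measurable]: "g i \<in> borel_measurable borel" if "i \<in> {1..n}" for i
        unfolding g_def[abs_def] using h_cont[OF that]
        by (intro borel_measurable_continuous_on_if continuous_on_const) simp_all
      have [measurable]: "(\<lambda>\<omega>. \<Sum>i=1..n. (g i (\<theta>s n \<omega>) - h n i \<theta>) * M n i \<theta> (X n i \<omega>))
          \<in> borel_measurable (P n)"
        using M_meas[OF _ Theta(2)] by (intro borel_measurable_sum borel_measurable_times) simp_all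
      have "(\<lambda>\<omega>. if \<theta>s n \<omega> \<in> \<Theta> then (\<Sum>i=1..n. (g i (\<theta>s n \<omega>) - h n i \<theta>)
          * M n i \<theta> (X n i \<omega>)) / sqrt (I n) else 0) \<in> borel_measurable (P n)"
        by measurable
      then show "(\<lambda>\<omega>. if \<theta>s n \<omega> \<in> \<Theta> then (\<Sum>i=1..n. (h n i (\<theta>s n \<omega>) - h n i \<theta>)
          * M n i \<theta> (X n i \<omega>)) / sqrt (I n) else 0) \<in> borel_measurable (P n)"
        by (simp add: g_def cong: if_cong)
    qed
    moreover have "(e2 \<longlongrightarrow> 0) (whp P)"
    proof (rule tendsto_0_ennreal_comparison)
      show "((\<lambda>x. 2 * (ennreal (D (fst x) (snd x)) * L (fst x) (D (fst x) (snd x)) (snd x)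
          / ennreal (sqrt (I (fst x))))) \<longlongrightarrow> 0) (whp P)"
        using ennreal_tendsto_cmult[OF _ R5_first', of 2] by simp
      show "\<forall>\<^sub>F x in whp P. ennreal \<bar>e2 x\<bar> \<le> 2 * (ennreal (D (fst x) (snd x)) *
          L (fst x) (D (fst x) (snd x)) (snd x) / ennreal (sqrt (I (fst x))))"
        using good t_in J_I
      proof eventually_elim
        case (elim x)
        from ennreal_abs_divide_le[OF sample_point.numerator_remainder[OF elim(1,2)], of "sqrt (I (fst x))"]
        show ?case unfolding e2_def L_def D_def t_def[symmetric]
          using elim by (simp add: ennreal_times_divide)
      qed
    qed
    ultimately have "((\<lambda>x. e1 (fst x) (snd x) + e2 x) \<longlongrightarrow> 0 + 0) (whp P)"
      by (intro tendsto_add)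
    moreover have "\<forall>\<^sub>F x in whp P. e1 (fst x) (snd x) + e2 x = E x"
      using t_in
    proof eventually_elim
      case (elim x)
      then have e1: "e1 (fst x) (snd x) = (\<Sum>i=1..fst x. (h (fst x) i (t x) - h (fst x) i \<theta>)
          * M (fst x) i \<theta> (X (fst x) i (snd x))) / sqrt (I (fst x))"
        by (simp add: e1_def t_def)
      show ?case
        unfolding e1 e2_def E_def G_def H_def Z_def sum_distrib_left
          add_divide_distrib[symmetric] diff_divide_distrib[symmetric] sum.distrib[symmetric] sum_subtractf[symmetric]
        by (simp add: algebra_simps)
    qed
    ultimately show ?thesis by (auto intro: Lim_transform_eventually)
  qed

  have Z_meas[measurable]: "Z n \<in> borel_measurable (P n)" for n
    unfolding Z_def[abs_def] using M_meas[OF _ Theta(2)]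
    by (intro borel_measurable_divide borel_measurable_sum borel_measurable_times) auto
  have Z_conv: "weak_conv_m (\<lambda>n. distr (P n) borel (Z n)) std_normal_distribution"
    using R3_clt by (simp add: Z_def[abs_def])
  have Z_bounded: "stoch_bounded P (\<lambda>x. Z (fst x) (snd x))"
    by (rule stoch_bounded_weak_conv[OF prob Z_meas real_dist_normal_dist std_normal_atomless Z_conv])

  \<comment> \<open>The error of \<open>s\<close> in units of its order of magnitude \<open>\<surd>I / |J|\<close>.\<close>
  define \<rho> where "\<rho> x = (s x - \<theta>) * J (fst x) / sqrt (I (fst x))" for x
  have s_eq: "\<forall>\<^sub>F x in whp P. (s x - \<theta>) * H x = - (sqrt (I (fst x)) * (Z (fst x) (snd x) + E x))"
    using H_nz J_I
  proof eventually_elim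
    case (elim x)
    then show ?case by (simp add: s_def E_def field_simps)
  qed
  have \<rho>_bounded: "stoch_bounded P \<rho>"
  proof (rule stoch_bounded_mono)
    have "((\<lambda>x. 1 / (H x / J (fst x))) \<longlongrightarrow> 1 / 1) (whp P)"
      by (intro tendsto_divide tendsto_const B_lim) simp
    then show "stoch_bounded P (\<lambda>x. (Z (fst x) (snd x) + E x) * (1 / (H x / J (fst x))))"
      by (intro stoch_bounded_mult stoch_bounded_add Z_bounded stoch_bounded_tendsto[OF E_lim])
        (rule stoch_bounded_tendsto)
    show "\<forall>\<^sub>F x in whp P. \<bar>\<rho> x\<bar> \<le> \<bar>(Z (fst x) (snd x) + E x) * (1 / (H x / J (fst x)))\<bar>"
      using s_eq H_nz J_I
    proof eventually_elim
      case (elim x)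
      have "s x - \<theta> = (s x - \<theta>) * H x / H x" using elim(2) by simp
      also note elim(1)
      finally have "\<rho> x = - ((Z (fst x) (snd x) + E x) * (1 / (H x / J (fst x))))"
        using elim(3) by (simp add: \<rho>_def)
      then show ?case by simp
    qed
  qed
  have abs_\<rho>_bounded: "stoch_bounded P (\<lambda>x. \<bar>\<rho> x\<bar>)"
    by (rule stoch_bounded_mono[OF \<rho>_bounded]) simp

  define r where "r x = \<bar>s x - \<theta>\<bar>" for x
  have r_nonneg: "0 \<le> r x" for x by (simp add: r_def)
  have r_\<rho>: "r x * \<bar>J (fst x)\<bar> / sqrt (I (fst x)) = \<bar>\<rho> x\<bar>" if "0 < I (fst x)" for x
    using that by (simp add: r_def \<rho>_def abs_mult)
  have r_lim: "(r \<longlongrightarrow> 0) (whp P)"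
  proof -
    have "((\<lambda>x. inverse (\<bar>J (fst x)\<bar> / sqrt (I (fst x)))) \<longlongrightarrow> 0) (whp P)"
      by (intro tendsto_inverse_0_at_top filterlim_compose[OF R3_ratio filterlim_fst_whp])
    from stoch_boundedD[OF abs_\<rho>_bounded this] show ?thesis
    proof (rule Lim_transform_eventually)
      show "\<forall>\<^sub>F x in whp P. \<bar>\<rho> x\<bar> * inverse (\<bar>J (fst x)\<bar> / sqrt (I (fst x))) = r x"
        using J_I by eventually_elim (simp add: r_\<rho>[symmetric])
    qed
  qed
  then have "(s \<longlongrightarrow> \<theta>) (whp P)"
    unfolding r_def[abs_def] by (simp add: tendsto_rabs_zero_iff LIM_zero_iff)
  then have s_in: "\<forall>\<^sub>F x in whp P. s x \<in> \<Theta>" using Theta by (intro topological_tendstoD)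

  define l where "l x = enn2real (L (fst x) (r x) (snd x) / ennreal \<bar>J (fst x)\<bar>)" for x
  have l_lim: "(l \<longlongrightarrow> 0) (whp P)"
    by (rule tendsto_0_ennreal_comparison[OF L_vanish[OF r_lim r_nonneg]])
      (auto simp: l_def ennreal_enn2real_if)
  define q2 where "q2 n \<omega> = (\<Sum>i=1..n. ((hbar n i)\<^sup>2 + (h n i \<theta>)\<^sup>2) * (M' n i \<theta> (X n i \<omega>))\<^sup>2) / (J n)\<^sup>2" for n \<omega>
  define q3 where "q3 n \<omega> = (\<Sum>i=1..n. (hbar n i)\<^sup>2 * (M n i \<theta> (X n i \<omega>))\<^sup>2)
             / (\<bar>J n\<bar> powr (2 * p) * I n powr (1 - p))" for n \<omega>
  have q2_lim: "((\<lambda>x. q2 (fst x) (snd x)) \<longlongrightarrow> 0) (whp P)"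
    unfolding q2_def using M'_meas[OF _ Theta(2)]
    by (intro tendsto_whp_of_tendsto_prob[OF R7_second] borel_measurable_divide borel_measurable_sum
        borel_measurable_times borel_measurable_power) auto
  have q3_lim: "((\<lambda>x. q3 (fst x) (snd x)) \<longlongrightarrow> 0) (whp P)"
    unfolding q3_def using M_meas[OF _ Theta(2)]
    by (intro tendsto_whp_of_tendsto_prob[OF R7_third] borel_measurable_divide borel_measurable_sum
        borel_measurable_times borel_measurable_power) auto
  have V0_lim: "((\<lambda>x. N \<theta> x / sqrt (I (fst x))) \<longlongrightarrow> 1) (whp P)"
  proof -
    have "((\<lambda>x. (\<Sum>i=1..fst x. (h (fst x) i \<theta>)\<^sup>2 * (M (fst x) i \<theta> (X (fst x) i (snd x)))\<^sup>2) / I (fst x)) \<longlongrightarrow> 1) (whp P)"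
      using M_meas[OF _ Theta(2)]
      by (intro tendsto_whp_of_tendsto_prob[OF R7_first] borel_measurable_divide borel_measurable_sum
          borel_measurable_times borel_measurable_power) auto
    from tendsto_real_sqrt[OF this] show ?thesis by (simp add: N_def real_sqrt_divide)
  qed
  have V_lim: "((\<lambda>x. N (s x) x / sqrt (I (fst x))) \<longlongrightarrow> 1) (whp P)"
  proof -
    \<comment> \<open>As \<open>p \<le> 1\<close>, the power \<open>|\<rho>|\<^sup>p\<close> is at most \<open>1 + |\<rho>|\<close>.\<close>
    have "stoch_bounded P (\<lambda>x. 1 + \<bar>\<rho> x\<bar>)"
      by (intro stoch_bounded_add abs_\<rho>_bounded stoch_bounded_tendsto[OF tendsto_const])
    then have \<rho>p_bounded: "stoch_bounded P (\<lambda>x. \<bar>\<rho> x\<bar> powr p)"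
    proof (rule stoch_bounded_mono, intro always_eventually allI)
      fix x
      have "\<bar>\<rho> x\<bar> powr p \<le> (1 + \<bar>\<rho> x\<bar>) powr p" using R2_p by (intro powr_mono2) auto
      also have "\<dots> \<le> (1 + \<bar>\<rho> x\<bar>) powr 1" using R2_p by (intro powr_mono) auto
      finally show "\<bar>\<bar>\<rho> x\<bar> powr p\<bar> \<le> \<bar>1 + \<bar>\<rho> x\<bar>\<bar>" by simp
    qed
    have "((\<lambda>x. N (s x) x / sqrt (I (fst x)) - N \<theta> x / sqrt (I (fst x))) \<longlongrightarrow> 0) (whp P)"
    proof (rule Lim_null_comparison)
      have "((\<lambda>x. \<bar>\<rho> x\<bar> powr p * sqrt (q3 (fst x) (snd x)) + \<bar>\<rho> x\<bar> * sqrt (2 * q2 (fst x) (snd x))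
          + \<bar>\<rho> x\<bar> * l x) \<longlongrightarrow> 0 + 0 + 0) (whp P)"
        using tendsto_real_sqrt[OF q3_lim] tendsto_real_sqrt[OF tendsto_mult_right_zero[OF q2_lim, of 2]]
        by (intro tendsto_add stoch_boundedD[OF \<rho>p_bounded] stoch_boundedD[OF abs_\<rho>_bounded] l_lim) simp_all
      then show "((\<lambda>x. \<bar>\<rho> x\<bar> powr p * sqrt (q3 (fst x) (snd x)) + \<bar>\<rho> x\<bar> * sqrt (2 * q2 (fst x) (snd x))
          + \<bar>\<rho> x\<bar> * l x) \<longlongrightarrow> 0) (whp P)" by simp
      have L_small: "\<forall>\<^sub>F x in whp P. L (fst x) (r x) (snd x) / ennreal \<bar>J (fst x)\<bar> < top"
        by (rule order_tendstoD(2)[OF L_vanish[OF r_lim r_nonneg]]) simp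
      have r_small: "\<forall>\<^sub>F x in whp P. r x < 1" by (rule order_tendstoD(2)[OF r_lim]) simp
      show "\<forall>\<^sub>F x in whp P. norm (N (s x) x / sqrt (I (fst x)) - N \<theta> x / sqrt (I (fst x)))
          \<le> \<bar>\<rho> x\<bar> powr p * sqrt (q3 (fst x) (snd x)) + \<bar>\<rho> x\<bar> * sqrt (2 * q2 (fst x) (snd x)) + \<bar>\<rho> x\<bar> * l x"
        using good s_in J_I L_small r_small
      proof eventually_elim
        case (elim x)
        let ?S3 = "\<Sum>i=1..fst x. (hbar (fst x) i)\<^sup>2 * (M (fst x) i \<theta> (X (fst x) i (snd x)))\<^sup>2"
        let ?S2 = "\<Sum>i=1..fst x. ((hbar (fst x) i)\<^sup>2 + (h (fst x) i \<theta>)\<^sup>2) * (M' (fst x) i \<theta> (X (fst x) i (snd x)))\<^sup>2"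
        have I: "0 < I (fst x)" and J: "J (fst x) \<noteq> 0" using elim by auto
        have "L (fst x) (r x) (snd x) \<le> ennreal (l x * \<bar>J (fst x)\<bar>)"
          unfolding l_def using elim(4) J by (intro ennreal_le_enn2real_divide) auto
        then have "\<bar>N (s x) x - N \<theta> x\<bar> \<le> r x powr p * sqrt ?S3 + r x * sqrt (2 * ?S2) + r x * (l x * \<bar>J (fst x)\<bar>)"
          unfolding N_def r_def L_def using elim(5)
          by (intro sample_point.norm_remainder[OF elim(1,2)]) (auto simp: l_def r_def)
        then have "\<bar>N (s x) x - N \<theta> x\<bar> / sqrt (I (fst x))
            \<le> (r x powr p * sqrt ?S3 + r x * sqrt (2 * ?S2) + r x * (l x * \<bar>J (fst x)\<bar>)) / sqrt (I (fst x))"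
          using I by (intro divide_right_mono) auto
        also have "\<dots> = r x powr p * sqrt ?S3 / sqrt (I (fst x)) + r x * sqrt (2 * ?S2) / sqrt (I (fst x))
            + r x * (l x * \<bar>J (fst x)\<bar>) / sqrt (I (fst x))"
          by (simp add: add_divide_distrib)
        also have "r x powr p * sqrt ?S3 / sqrt (I (fst x)) = \<bar>\<rho> x\<bar> powr p * sqrt (q3 (fst x) (snd x))"
          unfolding q3_def r_\<rho>[OF I, symmetric] by (rule powr_sqrt_rescale[OF r_nonneg _ I J]) (simp add: sum_nonneg)
        also have "r x * sqrt (2 * ?S2) / sqrt (I (fst x)) = \<bar>\<rho> x\<bar> * sqrt (2 * q2 (fst x) (snd x))"
          unfolding q2_def r_\<rho>[OF I, symmetric] using J by (simp add: real_sqrt_divide real_sqrt_mult)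
        also have "r x * (l x * \<bar>J (fst x)\<bar>) / sqrt (I (fst x)) = \<bar>\<rho> x\<bar> * l x"
          unfolding r_\<rho>[OF I, symmetric] by simp
        finally show ?case using I by (simp add: diff_divide_distrib[symmetric])
      qed
    qed
    from tendsto_add[OF this V0_lim] show ?thesis by simp
  qed
  have V_nz: "\<forall>\<^sub>F x in whp P. N (s x) x \<noteq> 0"
    using tendsto_imp_eventually_ne[OF V_lim, of 0] by (auto elim: eventually_mono)

  have d_defined_whp: "\<forall>\<^sub>F x in whp P. d_defined (fst x) (snd x)"
    using t_in H_nz s_in V_nz by eventually_elim (simp add: d_defined_iff)
  have d_defined_sets: "{\<omega> \<in> space (P n). d_defined n \<omega>} \<in> sets (P n)" for n
    using d_statistic[of n] by (simp add: rand_var_on_def)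
  define W where "W n \<omega> = (if d_defined n \<omega> then d n \<omega> * (\<theta>ss n \<omega> - \<theta>) else 0)" for n \<omega>
  \<comment> \<open>The product is measurable on the smaller of the two domains of definition and is \<open>0\<close> elsewhere.\<close>
  have W_meas: "W n \<in> borel_measurable (P n)" for n
  proof -
    have sub: "{\<omega> \<in> space (P n). d_defined n \<omega>} \<subseteq> {\<omega> \<in> space (P n). \<theta>ss_defined n \<omega>}"
      by (auto simp: d_defined_def \<theta>ss_defined_def d_star_defined_def Let_def)
    let ?R = "restrict_space (P n) {\<omega> \<in> space (P n). d_defined n \<omega>}"
    have "\<theta>ss n \<in> borel_measurable ?R"
      using \<theta>ss_statistic[of n] sub by (auto simp: rand_var_on_def intro: measurable_restrict_mono)
    moreover have "d n \<in> borel_measurable ?R"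
      using d_statistic[of n] by (simp add: rand_var_on_def)
    ultimately have "(\<lambda>\<omega>. d n \<omega> * (\<theta>ss n \<omega> - \<theta>)) \<in> borel_measurable ?R" by simp
    then have "(\<lambda>\<omega>. if \<omega> \<in> {\<omega> \<in> space (P n). d_defined n \<omega>} then d n \<omega> * (\<theta>ss n \<omega> - \<theta>) else 0)
        \<in> borel_measurable (P n)"
      using d_defined_sets[of n] by (subst (asm) measurable_restrict_space_iff[where c = 0]) auto
    then show ?thesis
      by (rule measurable_cong[THEN iffD1, rotated]) (simp add: W_def)
  qed
  \<comment> \<open>The studentized error is \<open>-(Z + E) / V\<close>; the sign of \<open>J\<close> cancels between \<open>H\<close> and \<open>s - \<theta>\<close>.\<close>
  have W_lim: "((\<lambda>x. W (fst x) (snd x) - - Z (fst x) (snd x)) \<longlongrightarrow> 0) (whp P)"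
  proof -
    define V where "V x = N (s x) x / sqrt (I (fst x))" for x
    have V_lim': "(V \<longlongrightarrow> 1) (whp P)" using V_lim by (simp add: V_def[abs_def])
    have "((\<lambda>x. 1 - 1 / V x) \<longlongrightarrow> 1 - 1 / 1) (whp P)"
      by (intro tendsto_intros V_lim') simp
    then have "((\<lambda>x. Z (fst x) (snd x) * (1 - 1 / V x)) \<longlongrightarrow> 0) (whp P)"
      by (intro stoch_boundedD[OF Z_bounded]) simp
    moreover have "((\<lambda>x. E x / V x) \<longlongrightarrow> 0 / 1) (whp P)"
      by (intro tendsto_divide E_lim V_lim') simp
    ultimately have "((\<lambda>x. Z (fst x) (snd x) * (1 - 1 / V x) - E x / V x) \<longlongrightarrow> 0 - 0 / 1) (whp P)"
      by (rule tendsto_diff)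
    moreover have "\<forall>\<^sub>F x in whp P. Z (fst x) (snd x) * (1 - 1 / V x) - E x / V x
        = W (fst x) (snd x) - - Z (fst x) (snd x)"
      using d_defined_whp s_eq V_nz J_I
    proof eventually_elim
      case (elim x)
      have "W (fst x) (snd x) = (s x - \<theta>) * H x / N (s x) x"
        using elim(1) by (simp add: W_def d_eq \<theta>ss_eq)
      also note elim(2)
      also have "- (sqrt (I (fst x)) * (Z (fst x) (snd x) + E x)) / N (s x) x = - (Z (fst x) (snd x) + E x) / V x"
        using elim(4) by (simp add: V_def minus_divide_left left_diff_distrib mult.commute[of "sqrt _"] distrib_right)
      finally show ?case by (simp add: algebra_simps diff_divide_distrib add_divide_distrib)
    qed
    ultimately show ?thesis by (auto intro: Lim_transform_eventually)
  qed
  have "weak_conv_m (\<lambda>n. distr (distr (P n) borel (Z n)) borel uminus) (distr std_normal_distribution borel uminus)"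
    by (intro weak_conv_m_distr_continuous Z_conv real_dist_normal_dist P.real_distribution_distr Z_meas)
      simp
  then have "weak_conv_m (\<lambda>n. distr (P n) borel (\<lambda>\<omega>. - Z n \<omega>)) std_normal_distribution"
    by (simp add: std_normal_symmetric distr_distr comp_def)
  from slutsky[OF prob _ W_meas real_dist_normal_dist std_normal_atomless this W_lim]
  have "weak_conv_m (\<lambda>n. distr (P n) borel (W n)) std_normal_distribution" by simp
  with measure_tendsto_1_whp[OF prob d_defined_sets d_defined_whp] show ?thesis
    by (simp add: W_def[abs_def])
qed

end
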